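(* Let $X$ be a compact metric space and $\sigma$ a homeomorphism of $X$ which preserves the metric on $X$ and has no periodic points, and let $\Sigma=(X,\sigma)$. Then for every irreducible representation $\pi$ of $C^*(\Sigma)$ on a Hilbert space, the restriction $\pi|_{\ell^1(\Sigma)}$ is not algebraically irreducible.
   Context: Let $\alpha(f)=f\circ\sigma^{-1}$ on $C(X)$. $\ell^1(\Sigma)=\ell^1(\mathbb{Z},C(X))$ is the Banach $*$-algebra with product $(fg)(n)=\sum_k f(k)\alpha^k(g(n-k))$, involution $f^*(n)=\alpha^n(f(-n))^*$ and norm $\|f\|_1=\sum_n\|f(n)\|$; $C^*(\Sigma)$ is its enveloping $C^*$-algebra (the crossed product of $C(X)$ by $\alpha$). A representation is algebraically irreducible if the only invariant linear subspaces (not necessarily closed) are $0$ and the whole space. *)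

theory Defs
  imports "HOL-Analysis.Analysis" "HOL-Algebra.Ring"
begin

section \<open>Complex Hilbert spaces\<close>

text \<open>The inner product is linear in the first argument. The axiom \<open>cinner_same\<close> contains
  positivity, definiteness, and the fact that the norm is the one given by the inner product.\<close>

class chilbert_space = banach +
  fixes scaleC :: "complex \<Rightarrow> 'a \<Rightarrow> 'a" (infixr \<open>*\<^sub>C\<close> 75)
    and cinner :: "'a \<Rightarrow> 'a \<Rightarrow> complex"
  assumes scaleC_add_right: "c *\<^sub>C (x + y) = c *\<^sub>C x + c *\<^sub>C y"
    and scaleC_add_left: "(c + d) *\<^sub>C x = c *\<^sub>C x + d *\<^sub>C x"
    and scaleC_scaleC: "c *\<^sub>C d *\<^sub>C x = (c * d) *\<^sub>C x"
    and scaleR_scaleC: "r *\<^sub>R x = complex_of_real r *\<^sub>C x"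
    and cinner_add_left: "cinner (x + y) z = cinner x z + cinner y z"
    and cinner_scaleC_left: "cinner (c *\<^sub>C x) y = c * cinner x y"
    and cinner_commute: "cinner y x = cnj (cinner x y)"
    and cinner_same: "cinner x x = complex_of_real ((norm x)\<^sup>2)"

definition csubspace :: "'h::chilbert_space set \<Rightarrow> bool" where
  "csubspace M \<longleftrightarrow> 0 \<in> M \<and> (\<forall>x\<in>M. \<forall>y\<in>M. x + y \<in> M) \<and> (\<forall>c. \<forall>x\<in>M. c *\<^sub>C x \<in> M)"

definition bounded_clinear :: "('h::chilbert_space \<Rightarrow> 'h) \<Rightarrow> bool" where
  "bounded_clinear T \<longleftrightarrow> bounded_linear T \<and> (\<forall>c x. T (c *\<^sub>C x) = c *\<^sub>C T x)"


section \<open>The Hilbert space of square summable functions on a type\<close>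

typedef 'i ell2 = "{f :: 'i \<Rightarrow> complex. (\<lambda>i. (cmod (f i))\<^sup>2) summable_on UNIV}"
  morphisms ell2_apply Abs_ell2
  by (rule exI[of _ "\<lambda>_. 0"]) simp

setup_lifting type_definition_ell2

lemma ell2_bound_finite:
  assumes "(\<lambda>i. (cmod (f i))\<^sup>2) summable_on UNIV" "finite F"
  shows "L2_set (\<lambda>i. cmod (f i)) F \<le> sqrt (\<Sum>\<^sub>\<infinity>i. (cmod (f i))\<^sup>2)"
  unfolding L2_set_def
  by (intro real_sqrt_le_mono finite_sum_le_infsum assms) auto

lemma ell2_of_bound:
  assumes "\<And>F. finite F \<Longrightarrow> L2_set (\<lambda>i. cmod (f i)) F \<le> b"
  shows "(\<lambda>i. (cmod (f i))\<^sup>2) summable_on UNIV \<and> sqrt (\<Sum>\<^sub>\<infinity>i. (cmod (f i))\<^sup>2) \<le> b"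
proof -
  have b: "0 \<le> b" using assms[of "{}"] by simp
  have le: "(\<Sum>i\<in>F. (cmod (f i))\<^sup>2) \<le> b\<^sup>2" if "finite F" for F
    using assms[OF that] by (auto simp: L2_set_def sqrt_le_D)
  have s: "(\<lambda>i. (cmod (f i))\<^sup>2) summable_on UNIV"
    by (rule nonneg_bdd_above_summable_on) (auto intro!: bdd_aboveI2[where M="b\<^sup>2"] le)
  moreover have "(\<Sum>\<^sub>\<infinity>i. (cmod (f i))\<^sup>2) \<le> b\<^sup>2"
    by (rule infsum_le_finite_sums[OF s]) (auto intro: le)
  ultimately show ?thesis using b by (simp add: real_le_lsqrt)
qed

lemma ell2_add:
  assumes f: "(\<lambda>i. (cmod (f i))\<^sup>2) summable_on UNIV" and g: "(\<lambda>i. (cmod (g i))\<^sup>2) summable_on UNIV"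
  shows "(\<lambda>i. (cmod (f i + g i))\<^sup>2) summable_on UNIV \<and>
    sqrt (\<Sum>\<^sub>\<infinity>i. (cmod (f i + g i))\<^sup>2) \<le>
      sqrt (\<Sum>\<^sub>\<infinity>i. (cmod (f i))\<^sup>2) + sqrt (\<Sum>\<^sub>\<infinity>i. (cmod (g i))\<^sup>2)"
proof (rule ell2_of_bound)
  fix F :: "'a set" assume F: "finite F"
  have "L2_set (\<lambda>i. cmod (f i + g i)) F \<le> L2_set (\<lambda>i. cmod (f i) + cmod (g i)) F"
    by (intro L2_set_mono norm_triangle_ineq) auto
  also have "\<dots> \<le> L2_set (\<lambda>i. cmod (f i)) F + L2_set (\<lambda>i. cmod (g i)) F"
    by (rule L2_set_triangle_ineq)
  also have "\<dots> \<le> sqrt (\<Sum>\<^sub>\<infinity>i. (cmod (f i))\<^sup>2) + sqrt (\<Sum>\<^sub>\<infinity>i. (cmod (g i))\<^sup>2)"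
    by (intro add_mono ell2_bound_finite f g F)
  finally show "L2_set (\<lambda>i. cmod (f i + g i)) F \<le> \<dots>" .
qed

lemma ell2_scale:
  assumes "(\<lambda>i. (cmod (f i))\<^sup>2) summable_on UNIV"
  shows "(\<lambda>i. (cmod (c * f i))\<^sup>2) summable_on UNIV"
  using summable_on_cmult_right[OF assms, of "(cmod c)\<^sup>2"]
  by (simp add: norm_mult power_mult_distrib)

lemma ell2_prod:
  assumes f: "(\<lambda>i. (cmod (f i))\<^sup>2) summable_on UNIV" and g: "(\<lambda>i. (cmod (g i))\<^sup>2) summable_on UNIV"
  shows "(\<lambda>i. f i * cnj (g i)) summable_on UNIV"
proof -
  have "(\<lambda>i. norm (f i * cnj (g i))) summable_on UNIV"
  proof (rule summable_on_comparison_test)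
    show "(\<lambda>i. (cmod (f i))\<^sup>2 + (cmod (g i))\<^sup>2) summable_on UNIV"
      by (rule summable_on_add[OF f g])
    fix i
    have "2 * cmod (f i) * cmod (g i) \<le> (cmod (f i))\<^sup>2 + (cmod (g i))\<^sup>2"
      by (rule sum_squares_bound)
    moreover have "0 \<le> cmod (f i) * cmod (g i)" by simp
    ultimately have "cmod (f i) * cmod (g i) \<le> (cmod (f i))\<^sup>2 + (cmod (g i))\<^sup>2"
      by linarith
    then show "norm (f i * cnj (g i)) \<le> (cmod (f i))\<^sup>2 + (cmod (g i))\<^sup>2"
      by (simp add: norm_mult)
  qed auto
  then show ?thesis by (rule abs_summable_summable)
qed

instantiation ell2 :: (type) real_normed_vector
begin

lift_definition zero_ell2 :: "'a ell2" is "\<lambda>_. 0" by simp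
lift_definition plus_ell2 :: "'a ell2 \<Rightarrow> 'a ell2 \<Rightarrow> 'a ell2" is "\<lambda>f g i. f i + g i"
  by (simp add: ell2_add)
lift_definition uminus_ell2 :: "'a ell2 \<Rightarrow> 'a ell2" is "\<lambda>f i. - f i" by simp
lift_definition minus_ell2 :: "'a ell2 \<Rightarrow> 'a ell2 \<Rightarrow> 'a ell2" is "\<lambda>f g i. f i - g i"
  subgoal for f g using ell2_add[of f "\<lambda>i. - g i"] by simp
  done
lift_definition scaleR_ell2 :: "real \<Rightarrow> 'a ell2 \<Rightarrow> 'a ell2" is "\<lambda>r f i. complex_of_real r * f i"
  by (rule ell2_scale)
lift_definition norm_ell2 :: "'a ell2 \<Rightarrow> real" is "\<lambda>f. sqrt (\<Sum>\<^sub>\<infinity>i. (cmod (f i))\<^sup>2)" .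

definition dist_ell2 :: "'a ell2 \<Rightarrow> 'a ell2 \<Rightarrow> real"
  where "dist_ell2 x y = norm (x - y)"
definition sgn_ell2 :: "'a ell2 \<Rightarrow> 'a ell2"
  where "sgn_ell2 x = inverse (norm x) *\<^sub>R x"
definition uniformity_ell2 :: "('a ell2 \<times> 'a ell2) filter"
  where "uniformity_ell2 = (INF e\<in>{0<..}. principal {(x, y). dist x y < e})"
definition open_ell2 :: "'a ell2 set \<Rightarrow> bool"
  where "open_ell2 U \<longleftrightarrow> (\<forall>x\<in>U. \<forall>\<^sub>F (x', y) in uniformity. x' = x \<longrightarrow> y \<in> U)"

instance
proof
  fix x y z :: "'a ell2" and r s :: real
  show "x + y + z = x + (y + z)" "x + y = y + x" "0 + x = x" "- x + x = 0" "x - y = x + - y"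
    by (transfer; simp add: algebra_simps)+
  show "r *\<^sub>R (x + y) = r *\<^sub>R x + r *\<^sub>R y" "(r + s) *\<^sub>R x = r *\<^sub>R x + s *\<^sub>R x"
    "r *\<^sub>R s *\<^sub>R x = (r * s) *\<^sub>R x" "1 *\<^sub>R x = x"
    by (transfer; simp add: algebra_simps)+
  show "dist x y = norm (x - y)" by (rule dist_ell2_def)
  show "sgn x = inverse (norm x) *\<^sub>R x" by (rule sgn_ell2_def)
  show "uniformity = (INF e\<in>{0<..}. principal {(x :: 'a ell2, y). dist x y < e})"
    by (rule uniformity_ell2_def)
  show "open U \<longleftrightarrow> (\<forall>x\<in>U. \<forall>\<^sub>F (x', y) in uniformity. x' = x \<longrightarrow> y \<in> U)" for U :: "'a ell2 set"
    by (rule open_ell2_def)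
  show "norm x = 0 \<longleftrightarrow> x = 0"
  proof transfer
    fix f :: "'a \<Rightarrow> complex"
    assume f: "(\<lambda>i. (cmod (f i))\<^sup>2) summable_on UNIV"
    show "sqrt (\<Sum>\<^sub>\<infinity>i. (cmod (f i))\<^sup>2) = 0 \<longleftrightarrow> f = (\<lambda>_. 0)"
    proof
      assume *: "sqrt (\<Sum>\<^sub>\<infinity>i. (cmod (f i))\<^sup>2) = 0"
      have "(cmod (f i))\<^sup>2 = 0" for i
        by (rule nonneg_infsum_le_0D[where A=UNIV and f="\<lambda>i. (cmod (f i))\<^sup>2"]) (use f * in auto)
      then show "f = (\<lambda>_. 0)" by auto
    qed simp
  qed
  show "norm (x + y) \<le> norm x + norm y"
    by transfer (simp add: ell2_add)
  show "norm (r *\<^sub>R x) = \<bar>r\<bar> * norm x"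
    by transfer (simp add: norm_mult power_mult_distrib infsum_cmult_right' real_sqrt_mult)
qed

end

lemma ell2_L2_set_le_norm: "finite F \<Longrightarrow> L2_set (\<lambda>i. cmod (ell2_apply x i)) F \<le> norm x"
  by transfer (simp add: ell2_bound_finite)

lemma ell2_apply_diff: "ell2_apply (x - y) i = ell2_apply x i - ell2_apply y i"
  by transfer simp

instance ell2 :: (type) banach
proof
  fix X :: "nat \<Rightarrow> 'a ell2" assume X: "Cauchy X"
  have "Cauchy (\<lambda>n. ell2_apply (X n) i)" for i
  proof (rule CauchyI)
    fix e :: real assume "0 < e"
    then obtain N where N: "\<And>m n. m \<ge> N \<Longrightarrow> n \<ge> N \<Longrightarrow> norm (X m - X n) < e"
      using CauchyD[OF X] by blast
    have "cmod (ell2_apply (X m) i - ell2_apply (X n) i) < e" if "m \<ge> N" "n \<ge> N" for m n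
      using ell2_L2_set_le_norm[of "{i}" "X m - X n"] N[OF that]
      by (simp add: L2_set_def ell2_apply_diff)
    then show "\<exists>N. \<forall>m\<ge>N. \<forall>n\<ge>N. norm (ell2_apply (X m) i - ell2_apply (X n) i) < e" by blast
  qed
  then have "\<exists>l. (\<lambda>n. ell2_apply (X n) i) \<longlonglongrightarrow> l" for i
    using Cauchy_convergent convergent_def by blast
  then obtain f where f: "\<And>i. (\<lambda>n. ell2_apply (X n) i) \<longlonglongrightarrow> f i" by metis
  have key: "\<exists>N. \<forall>n\<ge>N. \<forall>F. finite F \<longrightarrow> L2_set (\<lambda>i. cmod (f i - ell2_apply (X n) i)) F \<le> e"
    if e: "0 < e" for e
  proof -
    obtain N where N: "\<And>m n. m \<ge> N \<Longrightarrow> n \<ge> N \<Longrightarrow> norm (X m - X n) < e"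
      using CauchyD[OF X e] by blast
    have "L2_set (\<lambda>i. cmod (f i - ell2_apply (X n) i)) F \<le> e" if n: "n \<ge> N" and F: "finite F" for n F
    proof (rule LIMSEQ_le_const2)
      show "(\<lambda>m. L2_set (\<lambda>i. cmod (ell2_apply (X m) i - ell2_apply (X n) i)) F)
          \<longlonglongrightarrow> L2_set (\<lambda>i. cmod (f i - ell2_apply (X n) i)) F"
        unfolding L2_set_def by (intro tendsto_intros f)
      have "L2_set (\<lambda>i. cmod (ell2_apply (X m) i - ell2_apply (X n) i)) F \<le> e" if "m \<ge> N" for m
        using ell2_L2_set_le_norm[OF F, of "X m - X n"] N[OF that n] by (simp add: ell2_apply_diff)
      then show "\<exists>N. \<forall>m\<ge>N. L2_set (\<lambda>i. cmod (ell2_apply (X m) i - ell2_apply (X n) i)) F \<le> e"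
        by blast
    qed
    then show ?thesis by blast
  qed
  obtain N where N: "\<And>F. finite F \<Longrightarrow> L2_set (\<lambda>i. cmod (f i - ell2_apply (X N) i)) F \<le> 1"
    using key[of 1] by auto
  have "(\<lambda>i. (cmod (f i - ell2_apply (X N) i))\<^sup>2) summable_on UNIV"
    using ell2_of_bound[OF N] by blast
  moreover have "(\<lambda>i. (cmod (ell2_apply (X N) i))\<^sup>2) summable_on UNIV"
    using ell2_apply[of "X N"] by simp
  ultimately have fs: "(\<lambda>i. (cmod (f i))\<^sup>2) summable_on UNIV"
    using ell2_add[of "\<lambda>i. f i - ell2_apply (X N) i" "ell2_apply (X N)"] by simp
  define l where "l = Abs_ell2 f"
  have l: "ell2_apply l = f" unfolding l_def using fs by (simp add: Abs_ell2_inverse)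
  have "X \<longlonglongrightarrow> l"
  proof (rule LIMSEQ_I)
    fix e :: real assume "0 < e"
    then obtain N where N: "\<And>n F. n \<ge> N \<Longrightarrow> finite F \<Longrightarrow>
        L2_set (\<lambda>i. cmod (f i - ell2_apply (X n) i)) F \<le> e / 2"
      using key[of "e / 2"] by auto
    have "norm (X n - l) < e" if "n \<ge> N" for n
    proof -
      have "norm (l - X n) = sqrt (\<Sum>\<^sub>\<infinity>i. (cmod (f i - ell2_apply (X n) i))\<^sup>2)"
        by (simp add: norm_ell2.rep_eq ell2_apply_diff l)
      also have "\<dots> \<le> e / 2" using ell2_of_bound[OF N[OF that]] by blast
      finally show ?thesis using \<open>0 < e\<close> by (simp add: norm_minus_commute)
    qed
    then show "\<exists>N. \<forall>n\<ge>N. norm (X n - l) < e" by blast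
  qed
  then show "convergent X" by (auto simp: convergent_def)
qed

instantiation ell2 :: (type) chilbert_space
begin

lift_definition scaleC_ell2 :: "complex \<Rightarrow> 'a ell2 \<Rightarrow> 'a ell2" is "\<lambda>c f i. c * f i"
  by (rule ell2_scale)
lift_definition cinner_ell2 :: "'a ell2 \<Rightarrow> 'a ell2 \<Rightarrow> complex"
  is "\<lambda>f g. \<Sum>\<^sub>\<infinity>i. f i * cnj (g i)" .

instance
proof
  fix x y z :: "'a ell2" and r :: real and c d :: complex
  show "c *\<^sub>C (x + y) = c *\<^sub>C x + c *\<^sub>C y" "(c + d) *\<^sub>C x = c *\<^sub>C x + d *\<^sub>C x"
    "c *\<^sub>C d *\<^sub>C x = (c * d) *\<^sub>C x" "r *\<^sub>R x = complex_of_real r *\<^sub>C x"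
    by (transfer; simp add: algebra_simps)+
  show "cinner (x + y) z = cinner x z + cinner y z"
    by transfer (simp add: ring_distribs infsum_add ell2_prod)
  show "cinner (c *\<^sub>C x) y = c * cinner x y"
    by transfer (simp add: mult.assoc infsum_cmult_right')
  show "cinner y x = cnj (cinner x y)"
    by transfer (simp add: mult.commute flip: infsum_cnj)
  show "cinner x x = complex_of_real ((norm x)\<^sup>2)"
  proof transfer
    fix f :: "'a \<Rightarrow> complex"
    assume f: "(\<lambda>i. (cmod (f i))\<^sup>2) summable_on UNIV"
    have "((\<lambda>i. complex_of_real ((cmod (f i))\<^sup>2)) has_sum
        complex_of_real (\<Sum>\<^sub>\<infinity>i. (cmod (f i))\<^sup>2)) UNIV"
      using f by (intro has_sum_of_real has_sum_infsum) simp
    then have "(\<Sum>\<^sub>\<infinity>i. f i * cnj (f i)) = complex_of_real (\<Sum>\<^sub>\<infinity>i. (cmod (f i))\<^sup>2)"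
      unfolding complex_norm_square by (rule infsumI)
    then show "(\<Sum>\<^sub>\<infinity>i. f i * cnj (f i)) = complex_of_real ((sqrt (\<Sum>\<^sub>\<infinity>i. (cmod (f i))\<^sup>2))\<^sup>2)"
      by (simp add: infsum_nonneg)
  qed
qed

end


section \<open>Normed star-algebras, representations and enveloping algebras\<close>

record 'a star_algebra = "'a ring" +
  smult :: "complex \<Rightarrow> 'a \<Rightarrow> 'a"
  star :: "'a \<Rightarrow> 'a"
  nrm :: "'a \<Rightarrow> real"

text \<open>Unital \<open>C\<^sup>*\<close>-algebras (the unit being the one of \<^locale>\<open>ring\<close>).\<close>

locale cstar_algebra = ring B for B (structure) +
  assumes smult_closed: "x \<in> carrier B \<Longrightarrow> smult B c x \<in> carrier B"
    and smult_add_right: "\<lbrakk>x \<in> carrier B; y \<in> carrier B\<rbrakk> \<Longrightarrow>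
      smult B c (x \<oplus> y) = smult B c x \<oplus> smult B c y"
    and smult_add_left: "x \<in> carrier B \<Longrightarrow> smult B (c + d) x = smult B c x \<oplus> smult B d x"
    and smult_smult: "x \<in> carrier B \<Longrightarrow> smult B c (smult B d x) = smult B (c * d) x"
    and smult_one: "x \<in> carrier B \<Longrightarrow> smult B 1 x = x"
    and smult_mult_left: "\<lbrakk>x \<in> carrier B; y \<in> carrier B\<rbrakk> \<Longrightarrow>
      smult B c x \<otimes> y = smult B c (x \<otimes> y)"
    and smult_mult_right: "\<lbrakk>x \<in> carrier B; y \<in> carrier B\<rbrakk> \<Longrightarrow>
      x \<otimes> smult B c y = smult B c (x \<otimes> y)"
    and star_closed: "x \<in> carrier B \<Longrightarrow> star B x \<in> carrier B"
    and star_add: "\<lbrakk>x \<in> carrier B; y \<in> carrier B\<rbrakk> \<Longrightarrow> star B (x \<oplus> y) = star B x \<oplus> star B y"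
    and star_smult: "x \<in> carrier B \<Longrightarrow> star B (smult B c x) = smult B (cnj c) (star B x)"
    and star_mult: "\<lbrakk>x \<in> carrier B; y \<in> carrier B\<rbrakk> \<Longrightarrow> star B (x \<otimes> y) = star B y \<otimes> star B x"
    and star_star: "x \<in> carrier B \<Longrightarrow> star B (star B x) = x"
    and nrm_nonneg: "x \<in> carrier B \<Longrightarrow> 0 \<le> nrm B x"
    and nrm_eq_0: "x \<in> carrier B \<Longrightarrow> nrm B x = 0 \<longleftrightarrow> x = \<zero>"
    and nrm_triangle: "\<lbrakk>x \<in> carrier B; y \<in> carrier B\<rbrakk> \<Longrightarrow> nrm B (x \<oplus> y) \<le> nrm B x + nrm B y"
    and nrm_smult: "x \<in> carrier B \<Longrightarrow> nrm B (smult B c x) = cmod c * nrm B x"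
    and nrm_mult: "\<lbrakk>x \<in> carrier B; y \<in> carrier B\<rbrakk> \<Longrightarrow> nrm B (x \<otimes> y) \<le> nrm B x * nrm B y"
    and cstar_identity: "x \<in> carrier B \<Longrightarrow> nrm B (star B x \<otimes> x) = (nrm B x)\<^sup>2"
    and nrm_complete: "\<lbrakk>\<And>n::nat. u n \<in> carrier B;
        \<forall>e>0. \<exists>N. \<forall>m\<ge>N. \<forall>n\<ge>N. nrm B (u m \<ominus> u n) < e\<rbrakk> \<Longrightarrow>
      \<exists>l\<in>carrier B. (\<lambda>n. nrm B (u n \<ominus> l)) \<longlonglongrightarrow> 0"

definition star_hom :: "'a star_algebra \<Rightarrow> 'b star_algebra \<Rightarrow> ('a \<Rightarrow> 'b) \<Rightarrow> bool" where
  "star_hom A B \<phi> \<longleftrightarrow> \<phi> \<in> ring_hom A B \<and>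
    (\<forall>a\<in>carrier A. \<forall>c. \<phi> (smult A c a) = smult B c (\<phi> a)) \<and>
    (\<forall>a\<in>carrier A. \<phi> (star A a) = star B (\<phi> a))"

text \<open>Representations are not required to be unital, so degenerate ones are included.\<close>

definition star_rep :: "'a star_algebra \<Rightarrow> ('a \<Rightarrow> 'h \<Rightarrow> 'h::chilbert_space) \<Rightarrow> bool" where
  "star_rep A \<pi> \<longleftrightarrow>
    (\<forall>a\<in>carrier A. bounded_clinear (\<pi> a)) \<and>
    (\<forall>a\<in>carrier A. \<forall>b\<in>carrier A. \<forall>x. \<pi> (a \<oplus>\<^bsub>A\<^esub> b) x = \<pi> a x + \<pi> b x) \<and>
    (\<forall>a\<in>carrier A. \<forall>c x. \<pi> (smult A c a) x = c *\<^sub>C \<pi> a x) \<and>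
    (\<forall>a\<in>carrier A. \<forall>b\<in>carrier A. \<forall>x. \<pi> (a \<otimes>\<^bsub>A\<^esub> b) x = \<pi> a (\<pi> b x)) \<and>
    (\<forall>a\<in>carrier A. \<forall>x y. cinner (\<pi> (star A a) x) y = cinner x (\<pi> a y))"

definition invariant :: "'a star_algebra \<Rightarrow> ('a \<Rightarrow> 'h \<Rightarrow> 'h::chilbert_space) \<Rightarrow> 'h set \<Rightarrow> bool" where
  "invariant A \<pi> M \<longleftrightarrow> (\<forall>a\<in>carrier A. \<forall>x\<in>M. \<pi> a x \<in> M)"

text \<open>Topological irreducibility. The representation has to be nonzero: this excludes the space
  \<open>0\<close> and the zero representation on a one-dimensional space.\<close>

definition irreducible_rep :: "'a star_algebra \<Rightarrow> ('a \<Rightarrow> 'h \<Rightarrow> 'h::chilbert_space) \<Rightarrow> bool" where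
  "irreducible_rep A \<pi> \<longleftrightarrow> star_rep A \<pi> \<and> (\<exists>a\<in>carrier A. \<exists>x. \<pi> a x \<noteq> 0) \<and>
    (\<forall>M. csubspace M \<and> closed M \<and> invariant A \<pi> M \<longrightarrow> M = {0} \<or> M = UNIV)"

definition algebraically_irreducible ::
    "'a star_algebra \<Rightarrow> ('a \<Rightarrow> 'h \<Rightarrow> 'h::chilbert_space) \<Rightarrow> bool" where
  "algebraically_irreducible A \<pi> \<longleftrightarrow>
    (\<forall>M. csubspace M \<and> invariant A \<pi> M \<longrightarrow> M = {0} \<or> M = UNIV)"

text \<open>The norm \<open>sup {\<parallel>\<pi>(a)\<parallel> : \<pi> a representation of A}\<close>. The supremum over all Hilbert spaces
  equals the one over the space \<open>\<ell>\<^sup>2\<close> on the underlying type of \<open>A\<close>: it may be taken over cyclic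
  representations, a cyclic representation space has Hilbert dimension at most the cardinality
  of \<open>A\<close>, and a representation on a closed subspace extends by \<open>0\<close> on the orthogonal complement.\<close>

definition universal_norm :: "'a star_algebra \<Rightarrow> 'a \<Rightarrow> real" where
  "universal_norm A a =
    (SUP \<pi> \<in> {\<pi> :: 'a \<Rightarrow> 'a ell2 \<Rightarrow> 'a ell2. star_rep A \<pi>}. onorm (\<pi> a))"

text \<open>\<open>B\<close> together with \<open>\<iota> : A \<rightarrow> B\<close> is the enveloping \<open>C\<^sup>*\<close>-algebra of \<open>A\<close>, i.e. the (up to
  isomorphism unique) Hausdorff completion of \<open>A\<close> with respect to the universal norm.\<close>

definition enveloping_cstar_algebra ::
    "'a star_algebra \<Rightarrow> 'b star_algebra \<Rightarrow> ('a \<Rightarrow> 'b) \<Rightarrow> bool" where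
  "enveloping_cstar_algebra A B \<iota> \<longleftrightarrow> cstar_algebra B \<and> star_hom A B \<iota> \<and>
    (\<forall>a\<in>carrier A. nrm B (\<iota> a) = universal_norm A a) \<and>
    (\<forall>b\<in>carrier B. \<forall>e>0. \<exists>a\<in>carrier A. nrm B (b \<ominus>\<^bsub>B\<^esub> \<iota> a) < e)"


section \<open>The Banach star-algebra of a dynamical system\<close>

setup_lifting type_definition_bcontfun

text \<open>For compact \<open>X\<close> the type \<open>'x \<Rightarrow>\<^sub>C complex\<close> of bounded continuous functions, with its
  supremum norm, is \<open>C(X)\<close>.\<close>

lemma mult_cont:
  fixes f g :: "'x::topological_space \<Rightarrow> complex"
  assumes "f \<in> bcontfun" "g \<in> bcontfun"
  shows "(\<lambda>x. f x * g x) \<in> bcontfun"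
proof -
  obtain a b where ab: "\<And>x. norm (f x) \<le> a" "\<And>x. norm (g x) \<le> b"
    using assms by (auto simp: bcontfun_def bounded_iff)
  have "norm (f x * g x) \<le> a * b" for x
    unfolding norm_mult using ab(1)[of x] ab(2)[of x]
    by (intro mult_mono) (auto intro: order_trans[OF norm_ge_zero])
  then show ?thesis
    using assms by (intro bcontfun_normI) (auto simp: bcontfun_def intro!: continuous_intros)
qed

lift_definition C_mult :: "('x::topological_space \<Rightarrow>\<^sub>C complex) \<Rightarrow> ('x \<Rightarrow>\<^sub>C complex) \<Rightarrow> 'x \<Rightarrow>\<^sub>C complex"
  is "\<lambda>f g x. f x * g x"
  by (rule mult_cont)

lift_definition C_smult :: "complex \<Rightarrow> ('x::topological_space \<Rightarrow>\<^sub>C complex) \<Rightarrow> 'x \<Rightarrow>\<^sub>C complex"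
  is "\<lambda>c f x. c * f x"
  by (intro mult_cont const_bcontfun)

lift_definition C_cnj :: "('x::topological_space \<Rightarrow>\<^sub>C complex) \<Rightarrow> 'x \<Rightarrow>\<^sub>C complex"
  is "\<lambda>f x. cnj (f x)"
  by (auto simp: bcontfun_def bounded_iff intro!: continuous_intros)

text \<open>\<open>\<alpha>(f) = f \<circ> \<sigma>\<^sup>-\<^sup>1\<close>; \<open>inv_into UNIV\<close> is written out since the algebra library uses the
  notation \<open>inv\<close> for inverses in a group.\<close>

definition alpha :: "('x::topological_space \<Rightarrow> 'x) \<Rightarrow> ('x \<Rightarrow>\<^sub>C complex) \<Rightarrow> 'x \<Rightarrow>\<^sub>C complex" where
  "alpha \<sigma> f = Bcontfun (apply_bcontfun f \<circ> inv_into UNIV \<sigma>)"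

definition int_iterate :: "('a \<Rightarrow> 'a) \<Rightarrow> int \<Rightarrow> 'a \<Rightarrow> 'a" where
  "int_iterate h k = (if 0 \<le> k then h ^^ nat k else inv_into UNIV h ^^ nat (- k))"

definition ell1 :: "('x::metric_space \<Rightarrow> 'x) \<Rightarrow> (int \<Rightarrow> 'x \<Rightarrow>\<^sub>C complex) star_algebra" where
  "ell1 \<sigma> = \<lparr>
    carrier = {f. (\<lambda>n. norm (f n)) summable_on UNIV},
    monoid.mult = (\<lambda>f g n. \<Sum>\<^sub>\<infinity>k. C_mult (f k) (int_iterate (alpha \<sigma>) k (g (n - k)))),
    one = (\<lambda>n. if n = 0 then const_bcontfun 1 else 0),
    zero = (\<lambda>n. 0),
    add = (\<lambda>f g n. f n + g n),
    smult = (\<lambda>c f n. C_smult c (f n)),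
    star = (\<lambda>f n. C_cnj (int_iterate (alpha \<sigma>) n (f (- n)))),
    nrm = (\<lambda>f. \<Sum>\<^sub>\<infinity>n. norm (f n))\<rparr>"

end

theory Submission
  imports Defs
begin

text \<open>If \<open>\<pi>\<close> were algebraically irreducible on \<open>\<ell>\<^sup>1(\<Sigma>)\<close>, then every map \<open>f \<mapsto> \<pi>(f)\<xi>\<close> with \<open>\<xi> \<noteq> 0\<close> would be a
  bounded surjection of \<open>\<ell>\<^sup>1(\<Sigma>)\<close> onto the Hilbert space, so its adjoint would be bounded below: for
  some \<open>\<epsilon> > 0\<close>, \<open>sup {|\<langle>\<pi>(g) U\<^sup>n \<xi>, \<eta>\<rangle>| : n \<in> \<int>, \<parallel>g\<parallel> \<le> 1} \<ge> \<epsilon> \<parallel>\<eta>\<parallel>\<close> for all \<open>\<eta>\<close>, where \<open>U\<close> is the unitary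
  implementing \<open>\<alpha>\<close>. This fails for a suitable \<open>\<xi>\<close>. If the spectral measure of \<open>\<xi>\<close> on \<open>X\<close> has no
  atoms, it is uniformly small on all balls of a small radius; as \<open>\<sigma>\<close> maps balls to balls of the
  same radius, the same holds for all \<open>U\<^sup>n \<xi>\<close>, and one takes for \<open>\<eta>\<close> any vector supported in such a
  ball. If it has an atom, there is a common eigenvector \<open>\<xi>'\<close> of \<open>C(X)\<close>; its orbit under \<open>U\<close> is
  orthogonal since \<open>\<sigma>\<close> has no periodic points, and one takes for \<open>\<eta>\<close> the sum of \<open>N\<close> orbit vectors.\<close>

section \<open>Complex Hilbert spaces\<close>

lemma scaleC_one [simp]: "1 *\<^sub>C x = x" for x :: "'h::chilbert_space"
  using scaleR_scaleC[of 1 x] by simp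

lemma scaleC_minus_one: "(- 1) *\<^sub>C x = - x" for x :: "'h::chilbert_space"
  using scaleR_scaleC[of "- 1" x] by simp

lemma scaleC_zero_left [simp]: "0 *\<^sub>C x = 0" for x :: "'h::chilbert_space"
  using scaleR_scaleC[of 0 x] by simp

lemma cinner_zero_left [simp]: "cinner 0 y = 0" for y :: "'h::chilbert_space"
  using cinner_scaleC_left[of 0 y y] by simp

lemma cinner_minus_left: "cinner (- x) y = - cinner x y" for x y :: "'h::chilbert_space"
  using cinner_scaleC_left[of "- 1" x y] by (simp add: scaleC_minus_one)

lemma cinner_diff_left: "cinner (x - y) z = cinner x z - cinner y z"
  for x y z :: "'h::chilbert_space"
  using cinner_add_left[of x "- y" z] by (simp add: cinner_minus_left)

lemma cinner_add_right: "cinner x (y + z) = cinner x y + cinner x z"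
  for x y z :: "'h::chilbert_space"
  by (metis cinner_add_left cinner_commute complex_cnj_add)

lemma cinner_diff_right: "cinner x (y - z) = cinner x y - cinner x z"
  for x y z :: "'h::chilbert_space"
  by (metis cinner_diff_left cinner_commute complex_cnj_diff)

lemma cinner_scaleC_right: "cinner x (c *\<^sub>C y) = cnj c * cinner x y"
  for x y :: "'h::chilbert_space"
  by (metis cinner_scaleC_left cinner_commute complex_cnj_mult)

lemma cinner_zero_right [simp]: "cinner x 0 = 0" for x :: "'h::chilbert_space"
  by (metis cinner_zero_left cinner_commute complex_cnj_zero)

lemma cinner_sum_left: "cinner (sum f F) y = (\<Sum>i\<in>F. cinner (f i) y)"
  for y :: "'h::chilbert_space"
  by (induction F rule: infinite_finite_induct) (simp_all add: cinner_add_left)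

lemma cinner_sum_right: "cinner x (sum f F) = (\<Sum>i\<in>F. cinner x (f i))"
  for x :: "'h::chilbert_space"
  by (induction F rule: infinite_finite_induct) (simp_all add: cinner_add_right)

lemma norm_diff_square:
  "(norm (x - y))\<^sup>2 = (norm x)\<^sup>2 - 2 * Re (cinner x y) + (norm y)\<^sup>2"
  for x y :: "'h::chilbert_space"
proof -
  have "complex_of_real ((norm (x - y))\<^sup>2)
      = of_real ((norm x)\<^sup>2) - (cinner x y + cnj (cinner x y)) + of_real ((norm y)\<^sup>2)"
    unfolding cinner_same[symmetric] using cinner_commute[of y x]
    by (simp add: cinner_diff_left cinner_diff_right)
  then have "complex_of_real ((norm (x - y))\<^sup>2)
      = of_real ((norm x)\<^sup>2 - 2 * Re (cinner x y) + (norm y)\<^sup>2)"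
    by (simp add: complex_add_cnj)
  then show ?thesis by (simp only: of_real_eq_iff)
qed

lemma norm_scaleC: "norm (c *\<^sub>C x) = cmod c * norm x" for x :: "'h::chilbert_space"
proof -
  have "complex_of_real ((norm (c *\<^sub>C x))\<^sup>2) = c * cnj c * of_real ((norm x)\<^sup>2)"
    unfolding cinner_same[symmetric] by (simp add: cinner_scaleC_left cinner_scaleC_right)
  also have "\<dots> = complex_of_real ((cmod c * norm x)\<^sup>2)"
    by (simp only: complex_norm_square[symmetric] power_mult_distrib of_real_mult of_real_power)
  finally have "(norm (c *\<^sub>C x))\<^sup>2 = (cmod c * norm x)\<^sup>2" by (simp only: of_real_eq_iff)
  then show ?thesis by (simp add: power2_eq_iff_nonneg)
qed

lemma cinner_Cauchy_Schwarz: "cmod (cinner x y) \<le> norm x * norm y"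
  for x y :: "'h::chilbert_space"
proof (cases "y = 0")
  case False
  then have ny: "0 < norm y" by simp
  \<comment> \<open>With this \<open>c\<close>, the vector c y is the orthogonal projection of
    \<open>x\<close> onto the line spanned by \<open>y\<close>; the inequality is nonnegativity of
    the squared distance.\<close>
  define c where "c = cinner x y / of_real ((norm y)\<^sup>2)"
  have "Re (cinner x (c *\<^sub>C y)) = (cmod (cinner x y))\<^sup>2 / (norm y)\<^sup>2"
  proof -
    have "cinner x (c *\<^sub>C y) = cnj (cinner x y) * cinner x y / of_real ((norm y)\<^sup>2)"
      by (simp add: c_def cinner_scaleC_right)
    also have "\<dots> = of_real ((cmod (cinner x y))\<^sup>2 / (norm y)\<^sup>2)"
      by (simp add: complex_norm_square mult.commute del: of_real_power)
    finally show ?thesis by simp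
  qed
  moreover have "(norm (c *\<^sub>C y))\<^sup>2 = (cmod (cinner x y))\<^sup>2 / (norm y)\<^sup>2"
    using ny by (simp add: norm_scaleC c_def norm_divide power_mult_distrib power_divide
        norm_power norm_mult power2_eq_square)
  moreover have "0 \<le> (norm (x - c *\<^sub>C y))\<^sup>2" by simp
  ultimately have "(cmod (cinner x y))\<^sup>2 / (norm y)\<^sup>2 \<le> (norm x)\<^sup>2"
    unfolding norm_diff_square by simp
  then have "(cmod (cinner x y))\<^sup>2 \<le> (norm x * norm y)\<^sup>2"
    using ny by (simp add: divide_le_eq power_mult_distrib)
  then show ?thesis by (rule power2_le_imp_le) simp
qed simp

lemma norm_square_le_cmod: "(norm x)\<^sup>2 = cmod (cinner x x)" for x :: "'h::chilbert_space"
  by (simp add: cinner_same norm_power)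

lemma bounded_linear_cinner_left: "bounded_linear (\<lambda>x. cinner x y)"
  for y :: "'h::chilbert_space"
proof
  fix r :: real and x z :: 'h
  show "cinner (x + z) y = cinner x y + cinner z y" by (rule cinner_add_left)
  show "cinner (r *\<^sub>R x) y = r *\<^sub>R cinner x y"
    by (simp add: scaleR_scaleC cinner_scaleC_left scaleR_conv_of_real)
  show "\<exists>K. \<forall>x. norm (cinner x y) \<le> norm x * K"
    by (auto intro!: exI[of _ "norm y"] cinner_Cauchy_Schwarz)
qed

text \<open>The uniform boundedness principle for the functionals given by pairing with
  \<open>\<eta> j\<close>. The closed sets \<open>S N\<close> on which all of them are at most
  \<open>N\<close> cover the space, so by Baire one of them contains a ball.\<close>

lemma functionals_pointwise_bounded_imp_bounded:
  fixes \<eta> :: "nat \<Rightarrow> 'h::chilbert_space"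
  assumes "\<And>x. \<exists>N::nat. \<forall>j. cmod (cinner x (\<eta> j)) \<le> N"
  shows "\<exists>K. \<forall>j. norm (\<eta> j) \<le> K"
proof -
  define S where "S N = {x. \<forall>j. cmod (cinner x (\<eta> j)) \<le> real N}" for N
  have cl: "closed (S N)" for N
    unfolding S_def
    by (intro closed_Collect_all closed_Collect_le continuous_intros
        bounded_linear.continuous_on[OF bounded_linear_cinner_left] continuous_on_id)
  have un: "(\<Union>N. S N) = UNIV" using assms by (auto simp: S_def)
  have "\<exists>N. interior (S N) \<noteq> {}"
  proof (rule ccontr)
    assume "\<not> ?thesis"
    then have e: "interior (S N) = {}" for N by auto
    have "euclidean interior_of \<Union> (range S) = {}"
      using cl e
      by (intro Baire_category_alt)
        (auto simp: completely_metrizable_space_euclidean)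
    then show False using un by simp
  qed
  then obtain N x e where e: "0 < e" "cball x e \<subseteq> S N"
    by (metis ex_in_conv mem_interior_cball)
  have "norm (\<eta> j) \<le> 2 * real N / e" for j
  proof (cases "\<eta> j = 0")
    case False
    \<comment> \<open>The multiple of \<open>\<eta> j\<close> of norm \<open>e\<close>: it is the
      difference of the points \<open>x + y\<close> and \<open>x\<close> of \<open>S N\<close>, and
      pairing it with \<open>\<eta> j\<close> gives \<open>e * norm (\<eta> j)\<close>.\<close>
    define y where "y = (e / norm (\<eta> j)) *\<^sub>R \<eta> j"
    have "norm y = e" using False e by (simp add: y_def)
    then have "x + y \<in> S N" "x \<in> S N"
      using e by (auto simp: dist_norm intro!: subsetD[OF e(2)])
    then have "cmod (cinner (x + y) (\<eta> j)) \<le> N" "cmod (cinner x (\<eta> j)) \<le> N"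
      by (auto simp: S_def)
    then have "cmod (cinner y (\<eta> j)) \<le> 2 * N"
      using norm_triangle_ineq4[of "cinner (x + y) (\<eta> j)" "cinner x (\<eta> j)"]
      by (simp add: cinner_add_left)
    moreover have "cinner y (\<eta> j) = of_real (e * norm (\<eta> j))"
      using False
      by (simp add: y_def scaleR_scaleC cinner_scaleC_left cinner_same power2_eq_square)
    ultimately show ?thesis
      using e by (simp add: norm_mult field_simps)
  qed (use e in simp)
  then show ?thesis by blast
qed

section \<open>Absolutely summable families\<close>

text \<open>Tonelli for the family \<open>u k * v m\<close> on Z x Z, reindexed by the shear (n, k)
  -> (k, n - k). With \<open>u\<close> and \<open>v\<close> the norms of coefficients, this gives
  convergence of convolution products and submultiplicativity of the norm.\<close>

lemma discrete_convolution_nonneg: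
  fixes u v :: "int \<Rightarrow> real"
  assumes u: "u summable_on UNIV" "\<And>k. 0 \<le> u k" and v: "v summable_on UNIV" "\<And>k. 0 \<le> v k"
  shows "(\<lambda>k. u k * v (n - k)) summable_on UNIV"
    and "((\<lambda>n. \<Sum>\<^sub>\<infinity>k. u k * v (n - k)) has_sum infsum u UNIV * infsum v UNIV) UNIV"
proof -
  have "(\<lambda>(k, m). u k * v m) summable_on UNIV \<times> UNIV"
    using u v
    by (intro summable_on_SigmaI[where g = "\<lambda>k. u k * infsum v UNIV"])
      (auto intro!: has_sum_cmult_right has_sum_infsum summable_on_cmult_left)
  then have s: "((\<lambda>(k, m). u k * v m) has_sum (\<Sum>\<^sub>\<infinity>k. \<Sum>\<^sub>\<infinity>m. u k * v m)) (UNIV \<times> UNIV)"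
    using infsum_Sigma_banach[of "\<lambda>(k, m). u k * v m" UNIV "\<lambda>_. UNIV"]
    by (simp add: has_sum_iff)
  have "(\<Sum>\<^sub>\<infinity>k. \<Sum>\<^sub>\<infinity>m. u k * v m) = infsum u UNIV * infsum v UNIV"
    by (simp add: infsum_cmult_right' infsum_cmult_left')
  moreover have "bij_betw (\<lambda>(n, k). (k, n - k :: int)) (UNIV \<times> UNIV) (UNIV \<times> UNIV)"
    by (rule bij_betw_byWitness[where f' = "\<lambda>(k, m). (k + m, k)"]) auto
  ultimately have s': "((\<lambda>(n, k). u k * v (n - k)) has_sum infsum u UNIV * infsum v UNIV) (UNIV \<times> UNIV)"
    using has_sum_reindex_bij_betw[of "\<lambda>(n, k). (k, n - k :: int)" "UNIV \<times> UNIV" "UNIV \<times> UNIV"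
        "\<lambda>(k, m). u k * v m" "infsum u UNIV * infsum v UNIV"] s
    by (simp add: case_prod_unfold)
  show k: "(\<lambda>k. u k * v (n - k)) summable_on UNIV" for n
    using summable_on_SigmaD1[of "\<lambda>n k. u k * v (n - k)" UNIV "\<lambda>_. UNIV" n] has_sum_imp_summable[OF s']
    by simp
  show "((\<lambda>n. \<Sum>\<^sub>\<infinity>k. u k * v (n - k)) has_sum infsum u UNIV * infsum v UNIV) UNIV"
    using has_sum_SigmaD[OF s'] k by (simp add: has_sum_infsum)
qed

text \<open>Completeness of an l^1 space in the form used for power series: the sum is taken in each
  coordinate, and finite sums over \<open>F\<close> are exchanged with the series. The second
  estimate bounds the tail in l^1 norm.\<close>

lemma summable_on_norm_series:
  fixes d :: "nat \<Rightarrow> 'i \<Rightarrow> 'e::banach"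
  assumes d: "\<And>n. (\<lambda>i. norm (d n i)) summable_on UNIV" "\<And>n. (\<Sum>\<^sub>\<infinity>i. norm (d n i)) \<le> c n"
    and c: "summable c"
  shows "(\<lambda>i. norm (\<Sum>n. d n i)) summable_on UNIV"
    and "(\<Sum>\<^sub>\<infinity>i. norm ((\<Sum>n. d n i) - (\<Sum>n<N. d n i))) \<le> (\<Sum>n. c (n + N))"
proof -
  have le: "(\<Sum>i\<in>F. norm (d n i)) \<le> c n" if "finite F" for F n
    using finite_sum_le_infsum[OF d(1)[of n] that] d(2)[of n] by simp
  have s: "summable (\<lambda>n. norm (d n i))" for i
    by (rule summable_comparison_test[OF _ c]) (use le[of "{i}"] in auto)
  have tail: "(\<Sum>n. d n i) - (\<Sum>n<N. d n i) = (\<Sum>n. d (n + N) i)" for i N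
    using suminf_minus_initial_segment[OF summable_norm_cancel[OF s[of i]], of N] by simp
  have fin: "(\<Sum>i\<in>F. norm (\<Sum>n. d (n + N) i)) \<le> (\<Sum>n. c (n + N))" if F: "finite F" for F N
  proof -
    have s': "summable (\<lambda>n. norm (d (n + N) i))" for i
      using summable_ignore_initial_segment[OF s] .
    have "(\<Sum>i\<in>F. norm (\<Sum>n. d (n + N) i)) \<le> (\<Sum>i\<in>F. \<Sum>n. norm (d (n + N) i))"
      by (intro sum_mono summable_norm s')
    also have "\<dots> = (\<Sum>n. \<Sum>i\<in>F. norm (d (n + N) i))"
      by (rule suminf_sum[symmetric]) (rule s')
    also have "\<dots> \<le> (\<Sum>n. c (n + N))"
      by (intro suminf_le le F summable_sum s' summable_ignore_initial_segment c)
    finally show ?thesis .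
  qed
  have sm: "(\<lambda>i. norm (\<Sum>n. d (n + N) i)) summable_on UNIV" for N
    by (rule nonneg_bdd_above_summable_on)
      (auto intro!: bdd_aboveI2[where M = "\<Sum>n. c (n + N)"] fin)
  show "(\<lambda>i. norm (\<Sum>n. d n i)) summable_on UNIV"
    using sm[of 0] by simp
  show "(\<Sum>\<^sub>\<infinity>i. norm ((\<Sum>n. d n i) - (\<Sum>n<N. d n i))) \<le> (\<Sum>n. c (n + N))"
    unfolding tail by (rule infsum_le_finite_sums[OF sm]) (rule fin)
qed

text \<open>Class membership that makes absolutely summable families in C(X) summable, as the
  convolution product requires.\<close>

instance bcontfun :: (metric_space, banach) banach ..

section \<open>The algebra of a dynamical system\<close>

lemma norm_C_mult: "norm (C_mult f g) \<le> norm f * norm g"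
  by (rule norm_bound)
    (simp add: C_mult.rep_eq norm_mult mult_mono norm_bounded)

lemma norm_C_cnj: "norm (C_cnj f) \<le> norm f"
  by (rule norm_bound) (simp add: C_cnj.rep_eq norm_bounded)

lemma norm_C_smult: "norm (C_smult c f) \<le> cmod c * norm f"
  by (rule norm_bound) (simp add: C_smult.rep_eq norm_mult mult_left_mono norm_bounded)

lemma norm_const_one_le: "norm (const_bcontfun (1::complex) :: 'x::topological_space \<Rightarrow>\<^sub>C complex) \<le> 1"
  by (rule norm_bound) simp

lemma C_mult_simps [simp]:
  "C_mult 0 g = 0" "C_mult f 0 = 0"
  "C_mult (const_bcontfun 1) g = g" "C_mult f (const_bcontfun 1) = f"
  by (auto intro!: bcontfun_eqI simp: C_mult.rep_eq)

lemma C_mult_diff_left: "C_mult (f - g) h = C_mult f h - C_mult g h"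
  by (auto intro!: bcontfun_eqI simp: C_mult.rep_eq algebra_simps)

lemma C_cnj_simps [simp]: "C_cnj 0 = 0" "C_cnj (const_bcontfun 1) = const_bcontfun 1"
  by (auto intro!: bcontfun_eqI simp: C_cnj.rep_eq)

text \<open>The inverse is written \<open>inv_into UNIV \<sigma>\<close> because
  \<open>alpha\<close> and \<open>int_iterate\<close> are built from this function.\<close>

locale dynamical_system =
  fixes \<sigma> :: "'x::metric_space \<Rightarrow> 'x"
  assumes homeo: "homeomorphism UNIV UNIV \<sigma> (inv_into UNIV \<sigma>)"
begin

abbreviation A where "A \<equiv> ell1 \<sigma>"
abbreviation \<alpha> where "\<alpha> \<equiv> int_iterate (alpha \<sigma>)"
abbreviation \<tau> where "\<tau> \<equiv> int_iterate \<sigma>"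

text \<open>The monomial g u^n of the crossed product, where u implements \<alpha>. Finite sums of
  these are dense in l^1.\<close>

definition single :: "int \<Rightarrow> ('x \<Rightarrow>\<^sub>C complex) \<Rightarrow> int \<Rightarrow> 'x \<Rightarrow>\<^sub>C complex" where
  "single n g m = (if m = n then g else 0)"

lemma A_sel:
  "carrier A = {f. (\<lambda>n. norm (f n)) summable_on UNIV}"
  "f \<otimes>\<^bsub>A\<^esub> g = (\<lambda>n. \<Sum>\<^sub>\<infinity>k. C_mult (f k) (\<alpha> k (g (n - k))))"
  "\<one>\<^bsub>A\<^esub> = single 0 (const_bcontfun 1)"
  "f \<oplus>\<^bsub>A\<^esub> g = (\<lambda>n. f n + g n)"
  "smult A c f = (\<lambda>n. C_smult c (f n))"
  "star A f = (\<lambda>n. C_cnj (\<alpha> n (f (- n))))"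
  "nrm A f = (\<Sum>\<^sub>\<infinity>n. norm (f n))"
  by (auto simp: ell1_def single_def fun_eq_iff)

lemma inv_\<sigma>: "inv_into UNIV \<sigma> (\<sigma> x) = x" "\<sigma> (inv_into UNIV \<sigma> x) = x"
  using homeo by (auto simp: homeomorphism_def)

lemma alpha_apply: "apply_bcontfun (alpha \<sigma> f) x = apply_bcontfun f (inv_into UNIV \<sigma> x)"
proof -
  have "continuous_on UNIV (apply_bcontfun f \<circ> inv_into UNIV \<sigma>)"
    using homeo by (intro continuous_on_compose) (auto simp: homeomorphism_def)
  then have "apply_bcontfun f \<circ> inv_into UNIV \<sigma> \<in> bcontfun"
    by (rule bcontfun_normI[where b = "norm f"]) (simp add: norm_bounded)
  then show ?thesis by (simp add: alpha_def Bcontfun_inverse)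
qed

text \<open>Since \<open>inv_into\<close> merely chooses a preimage, f \<circ> \<sigma> is exhibited
  as one; evaluating \<open>alpha \<sigma>\<close> of the chosen preimage at
  \<open>\<sigma> x\<close> then determines it.\<close>

lemma inv_alpha_apply: "apply_bcontfun (inv_into UNIV (alpha \<sigma>) f) x = apply_bcontfun f (\<sigma> x)"
proof -
  have "continuous_on UNIV (apply_bcontfun f \<circ> \<sigma>)"
    using homeo by (intro continuous_on_compose) (auto simp: homeomorphism_def)
  then have "apply_bcontfun f \<circ> \<sigma> \<in> bcontfun"
    by (rule bcontfun_normI[where b = "norm f"]) (simp add: norm_bounded)
  then have "f = alpha \<sigma> (Bcontfun (apply_bcontfun f \<circ> \<sigma>))"
    by (auto intro!: bcontfun_eqI simp: alpha_apply Bcontfun_inverse inv_\<sigma>)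
  then have "alpha \<sigma> (inv_into UNIV (alpha \<sigma>) f) = f"
    by (metis f_inv_into_f rangeI)
  then show ?thesis
    by (metis alpha_apply inv_\<sigma>(1))
qed

lemma \<alpha>_apply: "apply_bcontfun (\<alpha> k f) x = apply_bcontfun f (\<tau> (- k) x)"
proof -
  have 1: "apply_bcontfun ((alpha \<sigma> ^^ n) f) x = apply_bcontfun f ((inv_into UNIV \<sigma> ^^ n) x)" for n x
    by (induction n arbitrary: x) (simp_all add: alpha_apply, simp add: funpow_swap1)
  have 2: "apply_bcontfun ((inv_into UNIV (alpha \<sigma>) ^^ n) f) x = apply_bcontfun f ((\<sigma> ^^ n) x)" for n x
    by (induction n arbitrary: x) (simp_all add: inv_alpha_apply, simp add: funpow_swap1)
  show ?thesis
    by (cases "k = 0") (auto simp: int_iterate_def 1 2)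
qed

lemma \<tau>_zero [simp]: "\<tau> 0 x = x"
  by (simp add: int_iterate_def)

lemma \<alpha>_zero_index [simp]: "\<alpha> 0 f = f"
  by (simp add: int_iterate_def)

lemma \<alpha>_simps [simp]: "\<alpha> k 0 = 0" "\<alpha> k (const_bcontfun 1) = const_bcontfun 1"
  by (auto intro!: bcontfun_eqI simp: \<alpha>_apply)

lemma norm_\<alpha>: "norm (\<alpha> k f) \<le> norm f"
  by (rule norm_bound) (simp add: \<alpha>_apply norm_bounded)

section \<open>Monomials and norm estimates for the operations of the algebra\<close>

lemma single_closed: "single n g \<in> carrier A"
  and nrm_single: "nrm A (single n g) = norm g"
proof -
  have "((\<lambda>m. norm (single n g m)) has_sum norm g) UNIV"
    by (rule has_sum_finite_neutralI[where B = "{n}"]) (auto simp: single_def)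
  then show "single n g \<in> carrier A" "nrm A (single n g) = norm g"
    by (auto simp: A_sel has_sum_imp_summable infsumI)
qed

lemma single_mult: "single n f \<otimes>\<^bsub>A\<^esub> single m g = single (n + m) (C_mult f (\<alpha> n g))"
proof
  fix j
  have "((\<lambda>k. C_mult (single n f k) (\<alpha> k (single m g (j - k)))) has_sum
      C_mult f (\<alpha> n (single m g (j - n)))) UNIV"
    by (rule has_sum_finite_neutralI[where B = "{n}"]) (auto simp: single_def)
  then show "(single n f \<otimes>\<^bsub>A\<^esub> single m g) j = single (n + m) (C_mult f (\<alpha> n g)) j"
    by (auto simp: A_sel infsumI single_def)
qed

lemma single_star: "star A (single n g) = single (- n) (C_cnj (\<alpha> (- n) g))"
  by (auto simp: A_sel single_def fun_eq_iff)

text \<open>The coefficients of the product are dominated by the convolution of the two sequences of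
  norms, since \<open>\<alpha> k\<close> does not increase the norm.\<close>

lemma
  assumes f: "f \<in> carrier A" and g: "g \<in> carrier A"
  shows summable_C_mult: "(\<lambda>k. C_mult (f k) (\<alpha> k (g (n - k)))) summable_on UNIV"
    and mult_closed: "f \<otimes>\<^bsub>A\<^esub> g \<in> carrier A"
    and nrm_mult_le: "nrm A (f \<otimes>\<^bsub>A\<^esub> g) \<le> nrm A f * nrm A g"
proof -
  have fs: "(\<lambda>n. norm (f n)) summable_on UNIV" and gs: "(\<lambda>n. norm (g n)) summable_on UNIV"
    using f g by (auto simp: A_sel)
  note conv = discrete_convolution_nonneg[OF fs _ gs, simplified]
  have le: "norm (C_mult (f k) (\<alpha> k (g (n - k)))) \<le> norm (f k) * norm (g (n - k))" for n k
    by (rule order_trans[OF norm_C_mult]) (simp add: mult_left_mono norm_\<alpha>)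
  have s: "(\<lambda>k. norm (C_mult (f k) (\<alpha> k (g (n - k))))) summable_on UNIV" for n
    by (rule summable_on_comparison_test[OF conv(1)]) (auto intro: le)
  show "(\<lambda>k. C_mult (f k) (\<alpha> k (g (n - k)))) summable_on UNIV"
    using s by (rule abs_summable_summable)
  have le': "norm ((f \<otimes>\<^bsub>A\<^esub> g) n) \<le> (\<Sum>\<^sub>\<infinity>k. norm (f k) * norm (g (n - k)))" for n
    unfolding A_sel
    by (rule order_trans[OF norm_infsum_bound[OF s]]) (intro infsum_mono s conv(1) le)
  have c: "(\<lambda>n. norm ((f \<otimes>\<^bsub>A\<^esub> g) n)) summable_on UNIV"
    by (rule summable_on_comparison_test[OF has_sum_imp_summable[OF conv(2)]]) (auto intro: le')
  then show "f \<otimes>\<^bsub>A\<^esub> g \<in> carrier A" by (simp add: A_sel(1))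
  have "nrm A (f \<otimes>\<^bsub>A\<^esub> g) \<le> (\<Sum>\<^sub>\<infinity>n. \<Sum>\<^sub>\<infinity>k. norm (f k) * norm (g (n - k)))"
    unfolding A_sel(7) by (intro infsum_mono c has_sum_imp_summable[OF conv(2)] le')
  also have "\<dots> = nrm A f * nrm A g"
    using infsumI[OF conv(2)] by (simp add: A_sel(7))
  finally show "nrm A (f \<otimes>\<^bsub>A\<^esub> g) \<le> nrm A f * nrm A g" .
qed

lemma
  assumes "f \<in> carrier A" "g \<in> carrier A"
  shows add_closed: "(\<lambda>n. f n + g n) \<in> carrier A"
    and diff_closed: "(\<lambda>n. f n - g n) \<in> carrier A"
    and nrm_diff_le: "nrm A (\<lambda>n. f n - g n) \<le> nrm A f + nrm A g"
proof -
  have s: "(\<lambda>n. norm (f n) + norm (g n)) summable_on UNIV"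
    using assms by (auto simp: A_sel intro: summable_on_add)
  have c: "(\<lambda>n. norm (f n + g n)) summable_on UNIV" "(\<lambda>n. norm (f n - g n)) summable_on UNIV"
    by (auto intro!: summable_on_comparison_test[OF s] norm_triangle_ineq norm_triangle_ineq4)
  then show "(\<lambda>n. f n + g n) \<in> carrier A" "(\<lambda>n. f n - g n) \<in> carrier A"
    by (auto simp: A_sel)
  have e: "nrm A f + nrm A g = (\<Sum>\<^sub>\<infinity>n. norm (f n) + norm (g n))"
    using assms by (auto simp: A_sel infsum_add)
  show "nrm A (\<lambda>n. f n - g n) \<le> nrm A f + nrm A g"
    unfolding e by (auto simp: A_sel(7) intro!: infsum_mono c s norm_triangle_ineq4)
qed

lemma
  assumes "f \<in> carrier A"
  shows smult_closed: "smult A c f \<in> carrier A"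
    and nrm_smult_le: "nrm A (smult A c f) \<le> cmod c * nrm A f"
proof -
  have s: "(\<lambda>n. cmod c * norm (f n)) summable_on UNIV"
    using assms by (auto simp: A_sel intro: summable_on_cmult_right)
  have c: "(\<lambda>n. norm (smult A c f n)) summable_on UNIV"
    by (auto intro!: summable_on_comparison_test[OF s] simp: A_sel norm_C_smult)
  then show "smult A c f \<in> carrier A" by (simp add: A_sel)
  have "nrm A (smult A c f) \<le> (\<Sum>\<^sub>\<infinity>n. cmod c * norm (f n))"
    unfolding A_sel(7) by (intro infsum_mono c s) (auto simp: A_sel norm_C_smult)
  then show "nrm A (smult A c f) \<le> cmod c * nrm A f"
    by (simp add: infsum_cmult_right' A_sel)
qed

lemma
  assumes "f \<in> carrier A"
  shows star_closed: "star A f \<in> carrier A"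
    and nrm_star_le: "nrm A (star A f) \<le> nrm A f"
proof -
  have b: "bij_betw uminus (UNIV :: int set) UNIV"
    by (rule bij_betw_byWitness[where f' = uminus]) auto
  have s: "(\<lambda>n. norm (f (- n))) summable_on UNIV"
    using assms summable_on_reindex_bij_betw[OF b, of "\<lambda>n. norm (f n)"] by (simp add: A_sel)
  have le: "norm (star A f n) \<le> norm (f (- n))" for n
    unfolding A_sel by (rule order_trans[OF norm_C_cnj norm_\<alpha>])
  have c: "(\<lambda>n. norm (star A f n)) summable_on UNIV"
    by (auto intro!: summable_on_comparison_test[OF s] le)
  then show "star A f \<in> carrier A" by (simp add: A_sel)
  have "nrm A (star A f) \<le> (\<Sum>\<^sub>\<infinity>n. norm (f (- n)))"
    unfolding A_sel(7) by (intro infsum_mono c s le)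
  also have "\<dots> = nrm A f"
    using infsum_reindex_bij_betw[OF b, of "\<lambda>n. norm (f n)"] by (simp add: A_sel)
  finally show "nrm A (star A f) \<le> nrm A f" .
qed

lemma nrm_nonneg: "0 \<le> nrm A f"
  by (simp add: A_sel infsum_nonneg)

section \<open>Neumann series\<close>

lemma mult_diff_left:
  assumes "f \<in> carrier A" "g \<in> carrier A" "h \<in> carrier A"
  shows "((\<lambda>n. f n - g n) \<otimes>\<^bsub>A\<^esub> h) n = (f \<otimes>\<^bsub>A\<^esub> h) n - (g \<otimes>\<^bsub>A\<^esub> h) n"
  using infsum_add[OF summable_C_mult[OF assms(1,3), of n], of
      "\<lambda>k. - C_mult (g k) (\<alpha> k (h (n - k)))"] summable_C_mult[OF assms(2,3), of n]
  by (simp add: A_sel C_mult_diff_left infsum_uminus summable_on_uminus)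

text \<open>The sum of the powers of \<open>h\<close>, a left inverse of 1 - h. Powers are formed by
  multiplying by \<open>h\<close> on the right, so the identity comes from the recursion for the
  partial sums and distributivity in the left factor.\<close>

lemma Neumann_series:
  assumes h: "h \<in> carrier A" and h1: "nrm A h < 1"
  shows "\<exists>b\<in>carrier A. \<forall>n. b n = \<one>\<^bsub>A\<^esub> n + (b \<otimes>\<^bsub>A\<^esub> h) n"
proof -
  define q where "q = nrm A h"
  have q: "0 \<le> q" "q < 1" using h1 by (simp_all add: q_def nrm_nonneg)
  define d where "d n = ((\<lambda>f. f \<otimes>\<^bsub>A\<^esub> h) ^^ n) \<one>\<^bsub>A\<^esub>" for n
  have d0: "d 0 = \<one>\<^bsub>A\<^esub>" and dS: "d (Suc n) = d n \<otimes>\<^bsub>A\<^esub> h" for n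
    by (simp_all add: d_def)
  have dc: "d n \<in> carrier A" for n
    by (induction n) (simp_all add: d0 dS A_sel(3) single_closed mult_closed h)
  have dn: "nrm A (d n) \<le> q ^ n" for n
  proof (induction n)
    case (Suc n)
    have "nrm A (d (Suc n)) \<le> nrm A (d n) * q"
      using nrm_mult_le[OF dc h] by (simp add: dS q_def)
    also have "\<dots> \<le> q ^ n * q" by (rule mult_right_mono[OF Suc q(1)])
    finally show ?case by (simp add: mult.commute)
  qed (simp add: d0 A_sel(3) nrm_single norm_const_one_le)
  define b where "b i = (\<Sum>n. d n i)" for i
  define p where "p N i = (\<Sum>n<N. d n i)" for N i
  have ser: "(\<lambda>i. norm (d n i)) summable_on UNIV" "(\<Sum>\<^sub>\<infinity>i. norm (d n i)) \<le> q ^ n" for n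
    using dc[of n] dn[of n] by (auto simp: A_sel)
  have geo: "summable (\<lambda>n. q ^ n)" using q by (simp add: summable_geometric)
  have bc: "b \<in> carrier A"
    using summable_on_norm_series(1)[of d "\<lambda>n. q ^ n", OF ser geo] by (simp add: A_sel b_def)
  have tail: "nrm A (\<lambda>i. b i - p N i) \<le> q ^ N / (1 - q)" for N
  proof -
    have "nrm A (\<lambda>i. b i - p N i) \<le> (\<Sum>n. q ^ (n + N))"
      using summable_on_norm_series(2)[of d "\<lambda>n. q ^ n", OF ser geo, of N] by (simp add: A_sel b_def p_def)
    also have "\<dots> = q ^ N / (1 - q)"
      using q by (simp add: power_add suminf_mult2[symmetric] geo suminf_geometric)
    finally show ?thesis .
  qed
  have p0: "p 0 = (\<lambda>_. 0)" and pS: "p (Suc N) = (\<lambda>i. p N i + d N i)" for N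
    by (simp_all add: p_def fun_eq_iff)
  have pc: "p N \<in> carrier A" for N
    by (induction N) (auto simp: pS p0 dc add_closed, auto simp: A_sel)
  have pstep: "p (Suc N) i = \<one>\<^bsub>A\<^esub> i + (p N \<otimes>\<^bsub>A\<^esub> h) i" for N i
  proof (induction N)
    case 0
    have "(p 0 \<otimes>\<^bsub>A\<^esub> h) i = 0" by (simp add: A_sel p0)
    then show ?case by (simp only: pS p0 d0) simp
  next
    case (Suc N)
    have "(d N \<otimes>\<^bsub>A\<^esub> h) i = (p (Suc N) \<otimes>\<^bsub>A\<^esub> h) i - (p N \<otimes>\<^bsub>A\<^esub> h) i"
      using mult_diff_left[OF pc[of "Suc N"] pc[of N] h, of i] by (simp add: pS)
    then show ?case
      using Suc by (simp add: pS[of "Suc N"] dS)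
  qed
  \<comment> \<open>The defect of the identity. Subtracting the recursion for the partial sums
    writes it as (b - p (N+1)) - (b - p N) h, whose norm is at most a constant times q^N for every
    \<open>N\<close>.\<close>
  define z where "z i = b i - (\<one>\<^bsub>A\<^esub> i + (b \<otimes>\<^bsub>A\<^esub> h) i)" for i
  have oc: "\<one>\<^bsub>A\<^esub> \<in> carrier A" by (simp add: A_sel(3) single_closed)
  have zc: "z \<in> carrier A"
    unfolding z_def by (intro diff_closed add_closed bc oc mult_closed h)
  have "nrm A z \<le> 2 / (1 - q) * q ^ N" for N
  proof -
    let ?r = "\<lambda>i. b i - p N i" and ?r' = "\<lambda>i. b i - p (Suc N) i"
    have rc: "?r \<in> carrier A" "?r' \<in> carrier A" by (intro diff_closed bc pc)+
    have "z = (\<lambda>i. ?r' i - (?r \<otimes>\<^bsub>A\<^esub> h) i)"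
      by (simp add: z_def fun_eq_iff mult_diff_left[OF bc pc h] pstep)
    then have "nrm A z \<le> nrm A ?r' + nrm A (?r \<otimes>\<^bsub>A\<^esub> h)"
      using nrm_diff_le[OF rc(2) mult_closed[OF rc(1) h]] by simp
    also have "\<dots> \<le> nrm A ?r' + nrm A ?r * q"
      using nrm_mult_le[OF rc(1) h] by (simp add: q_def)
    also have "\<dots> \<le> q ^ Suc N / (1 - q) + q ^ N / (1 - q) * q"
      by (intro add_mono mult_right_mono tail q)
    also have "\<dots> = q * (2 / (1 - q) * q ^ N)" by (simp add: field_simps)
    also have "\<dots> \<le> 1 * (2 / (1 - q) * q ^ N)" using q by (intro mult_right_mono) auto
    finally show ?thesis by simp
  qed
  moreover have "(\<lambda>N. 2 / (1 - q) * q ^ N) \<longlonglongrightarrow> 0"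
    using q by (intro tendsto_mult_right_zero LIMSEQ_power_zero) auto
  ultimately have "nrm A z \<le> 0"
    by (intro LIMSEQ_le_const[of _ _ "nrm A z"]) auto
  then have "z n = 0" for n
    using nonneg_infsum_le_0D[of "\<lambda>n. norm (z n)" UNIV n] zc by (simp add: A_sel)
  then show ?thesis using bc by (auto simp: z_def)
qed

end

section \<open>Unital representations\<close>

lemma C_mult_commute: "C_mult f g = C_mult g f"
  by (auto intro!: bcontfun_eqI simp: C_mult.rep_eq)

text \<open>Isolates what is used of the restriction to l^1 of an irreducible representation of the
  enveloping algebra.\<close>

locale unital_rep = dynamical_system \<sigma> for \<sigma> :: "'x::metric_space \<Rightarrow> 'x" +
  fixes \<rho> :: "(int \<Rightarrow> 'x \<Rightarrow>\<^sub>C complex) \<Rightarrow> 'h \<Rightarrow> 'h::chilbert_space"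
  assumes rep: "star_rep A \<rho>"
    and unital: "\<rho> \<one>\<^bsub>A\<^esub> x = x"
begin

lemma
  assumes "f \<in> carrier A"
  shows rep_bounded_linear: "bounded_linear (\<rho> f)"
    and rep_scaleC: "\<rho> f (c *\<^sub>C x) = c *\<^sub>C \<rho> f x"
    and rep_smult: "\<rho> (smult A c f) x = c *\<^sub>C \<rho> f x"
    and rep_star: "cinner (\<rho> (star A f) x) y = cinner x (\<rho> f y)"
    and rep_add: "g \<in> carrier A \<Longrightarrow> \<rho> (\<lambda>n. f n + g n) x = \<rho> f x + \<rho> g x"
    and rep_mult: "g \<in> carrier A \<Longrightarrow> \<rho> (f \<otimes>\<^bsub>A\<^esub> g) x = \<rho> f (\<rho> g x)"
  using assms rep unfolding star_rep_def bounded_clinear_def A_sel(4) by blast+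

text \<open>If \<open>\<parallel>T\<parallel>\<^sup>2 > \<parallel>f\<parallel>\<^sup>2\<close> for \<open>T = \<rho> f\<close>, then \<open>1 - f\<^sup>* f / \<parallel>T\<parallel>\<^sup>2\<close> has a left inverse by the Neumann series,
  so \<open>1 - T\<^sup>* T / \<parallel>T\<parallel>\<^sup>2\<close> is bounded below. But almost norming vectors of \<open>T\<close> are almost in its kernel.\<close>

lemma norm_rep_le:
  assumes f: "f \<in> carrier A"
  shows "norm (\<rho> f x) \<le> nrm A f * norm x"
proof -
  note bl = rep_bounded_linear[OF f]
  define m where "m = onorm (\<rho> f)"
  have le_m: "norm (\<rho> f x) \<le> m * norm x" for x
    unfolding m_def by (rule onorm[OF bl])
  have "m \<le> nrm A f"
  proof (rule ccontr)
    assume "\<not> ?thesis"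
    then have lt: "nrm A f < m" by simp
    then have m: "0 < m" using nrm_nonneg[of f] by linarith
    \<comment> \<open>Its norm is less than 1 because \<open>nrm A f < m\<close>; it is represented
      by the positive operator T^* T / m^2 for T = \<rho> f.\<close>
    define h where "h = smult A (of_real (1 / m\<^sup>2)) (star A f \<otimes>\<^bsub>A\<^esub> f)"
    note sc = star_closed[OF f]
    have sfc: "star A f \<otimes>\<^bsub>A\<^esub> f \<in> carrier A" by (rule mult_closed[OF sc f])
    have hc: "h \<in> carrier A" unfolding h_def by (rule smult_closed[OF sfc])
    have "nrm A h \<le> 1 / m\<^sup>2 * nrm A (star A f \<otimes>\<^bsub>A\<^esub> f)"
      using nrm_smult_le[OF sfc, of "of_real (1 / m\<^sup>2)"]
      by (simp add: h_def norm_divide norm_power)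
    also have "\<dots> \<le> 1 / m\<^sup>2 * (nrm A f * nrm A f)"
      by (intro mult_left_mono order_trans[OF nrm_mult_le[OF sc f]] mult_right_mono
          nrm_star_le f nrm_nonneg) simp
    also have "\<dots> < 1"
      using m lt nrm_nonneg[of f] by (simp add: power2_eq_square mult_strict_mono' divide_less_eq)
    finally obtain b where b: "b \<in> carrier A" "b = (\<lambda>n. \<one>\<^bsub>A\<^esub> n + (b \<otimes>\<^bsub>A\<^esub> h) n)"
      using Neumann_series[OF hc] by auto
    \<comment> \<open>Bounds the norm of the left inverse of 1 - h; the maximum with 1 keeps 1 - 1 /
      K^2 nonnegative and less than 1.\<close>
    define K where "K = max 1 (onorm (\<rho> b))"
    have K: "1 \<le> K" by (simp add: K_def)
    have bound: "norm (\<rho> f x) \<le> m * sqrt (1 - 1 / K\<^sup>2) * norm x" for x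
    proof -
      define y where "y = \<rho> f x"
      define z where "z = \<rho> (star A f) y"
      define w where "w = complex_of_real (1 / m\<^sup>2) *\<^sub>C z"
      have hx: "\<rho> h x = w"
        by (simp only: h_def rep_smult[OF sfc] rep_mult[OF sc f] w_def z_def y_def)
      have oc: "\<one>\<^bsub>A\<^esub> \<in> carrier A" by (simp add: A_sel(3) single_closed)
      have "\<rho> b x = \<rho> (\<lambda>n. \<one>\<^bsub>A\<^esub> n + (b \<otimes>\<^bsub>A\<^esub> h) n) x"
        by (rule arg_cong[OF b(2)])
      also have "\<dots> = x + \<rho> b w"
        by (simp only: rep_add[OF oc mult_closed[OF b(1) hc]] unital rep_mult[OF b(1) hc] hx)
      finally have "x = \<rho> b (x - w)"
        using linear_diff[OF bounded_linear.linear[OF rep_bounded_linear[OF b(1)]], of x w] by simp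
      then have "norm x \<le> onorm (\<rho> b) * norm (x - w)"
        using onorm[OF rep_bounded_linear[OF b(1)], of "x - w"] by simp
      also have "\<dots> \<le> K * norm (x - w)" by (simp add: K_def mult_right_mono)
      finally have 1: "(norm x)\<^sup>2 \<le> K\<^sup>2 * (norm (x - w))\<^sup>2"
        using power_mono[of "norm x" "K * norm (x - w)" 2] by (simp add: power_mult_distrib)
      \<comment> \<open>The adjoint of \<open>\<rho> f\<close> also has norm at most
        \<open>m\<close>: the square of \<open>norm z\<close> equals
        \<open>cinner y (\<rho> f z)\<close>.\<close>
      have "(norm z)\<^sup>2 \<le> norm y * norm (\<rho> f z)"
        using cinner_Cauchy_Schwarz[of y "\<rho> f z"] rep_star[OF f, of y z]
        by (simp add: norm_square_le_cmod z_def)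
      also have "\<dots> \<le> norm y * (m * norm z)" by (intro mult_left_mono le_m) simp
      finally have "norm z \<le> m * norm y"
        using m by (cases "norm z = 0") (auto simp: power2_eq_square mult.commute)
      then have z2: "(norm z)\<^sup>2 \<le> m\<^sup>2 * (norm y)\<^sup>2"
        using power_mono[of "norm z" "m * norm y" 2] by (simp add: power_mult_distrib)
      have "(norm z)\<^sup>2 / (m\<^sup>2 * m\<^sup>2) \<le> m\<^sup>2 * (norm y)\<^sup>2 / (m\<^sup>2 * m\<^sup>2)"
        by (rule divide_right_mono[OF z2]) simp
      also have "\<dots> = (norm y)\<^sup>2 / m\<^sup>2"
        by (rule nonzero_mult_divide_mult_cancel_left) (use m in simp)
      finally have z2': "(norm z)\<^sup>2 / (m\<^sup>2 * m\<^sup>2) \<le> (norm y)\<^sup>2 / m\<^sup>2" .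
      have "cinner z x = complex_of_real ((norm y)\<^sup>2)"
        using rep_star[OF f, of y x] by (simp add: z_def y_def cinner_same)
      then have "cinner x w = complex_of_real ((norm y)\<^sup>2 / m\<^sup>2)"
        using cinner_commute[of x z] by (simp add: w_def cinner_scaleC_right)
      \<comment> \<open>The cross term outweighs the last one and leaves a decrease of (norm y)^2 /
        m^2. Against the lower bound for \<open>norm (x - w)\<close>, this forces
        \<open>norm y\<close> below \<open>m * norm x\<close> by a fixed factor.\<close>
      then have "(norm (x - w))\<^sup>2 = (norm x)\<^sup>2 - 2 * ((norm y)\<^sup>2 / m\<^sup>2) + (norm z)\<^sup>2 / (m\<^sup>2 * m\<^sup>2)"
        by (simp only: norm_diff_square)
          (simp add: w_def norm_scaleC norm_divide norm_power norm_mult power_divide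
            power_mult_distrib power2_eq_square)
      also have "\<dots> \<le> (norm x)\<^sup>2 - 2 * ((norm y)\<^sup>2 / m\<^sup>2) + (norm y)\<^sup>2 / m\<^sup>2"
        using z2' by linarith
      finally have "(norm (x - w))\<^sup>2 \<le> (norm x)\<^sup>2 - (norm y)\<^sup>2 / m\<^sup>2" by simp
      then have "(norm x)\<^sup>2 \<le> K\<^sup>2 * ((norm x)\<^sup>2 - (norm y)\<^sup>2 / m\<^sup>2)"
        by (rule order_trans[OF 1 mult_left_mono]) simp
      then have "(norm x)\<^sup>2 / K\<^sup>2 \<le> (norm x)\<^sup>2 - (norm y)\<^sup>2 / m\<^sup>2"
        using K by (simp add: divide_le_eq mult.commute)
      then have "(norm y)\<^sup>2 / m\<^sup>2 \<le> (1 - 1 / K\<^sup>2) * (norm x)\<^sup>2"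
        by (simp add: left_diff_distrib)
      then have "(norm y)\<^sup>2 \<le> m\<^sup>2 * (1 - 1 / K\<^sup>2) * (norm x)\<^sup>2"
        using m by (simp add: pos_divide_le_eq mult_ac)
      also have "\<dots> = (m * sqrt (1 - 1 / K\<^sup>2) * norm x)\<^sup>2"
        using K by (simp add: power_mult_distrib)
      finally show ?thesis
        unfolding y_def by (rule power2_le_imp_le) (use m K in simp)
    qed
    have "onorm (\<rho> f) \<le> m * sqrt (1 - 1 / K\<^sup>2)"
      by (rule onorm_bound[OF _ bound]) (use m K in simp)
    then have "m \<le> m * sqrt (1 - 1 / K\<^sup>2)" by (simp only: m_def)
    moreover have "sqrt (1 - 1 / K\<^sup>2) < 1" using K by simp
    ultimately show False using m by simp
  qed
  then show ?thesis
    using le_m[of x] mult_right_mono[of m "nrm A f" "norm x"] by simp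
qed

section \<open>The covariant pair of a representation\<close>

definition E where "E g = \<rho> (single 0 g)"
text \<open>\<open>V n\<close> is the n-th power of the unitary U implementing \<alpha>, and
  \<open>E\<close> is the representation of C(X). Monomials act by \<open>E g (V n x)\<close>, so by
  continuity the pair determines \<rho>.\<close>

definition V where "V n = \<rho> (single n (const_bcontfun 1))"

lemma E_linear:
  "E g (x + y) = E g x + E g y" "E g (x - y) = E g x - E g y" "E g 0 = 0"
  "E g (c *\<^sub>C x) = c *\<^sub>C E g x"
  using bounded_linear.linear[OF rep_bounded_linear[OF single_closed[of 0 g]]]
  by (simp_all add: E_def linear_add linear_diff linear_0 rep_scaleC single_closed)

lemma V_linear:
  "V n (x + y) = V n x + V n y" "V n (x - y) = V n x - V n y" "V n 0 = 0"
  "V n (c *\<^sub>C x) = c *\<^sub>C V n x"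
  using bounded_linear.linear[OF rep_bounded_linear[OF single_closed[of n "const_bcontfun 1"]]]
  by (simp_all add: V_def linear_add linear_diff linear_0 rep_scaleC single_closed)

lemma E_one [simp]: "E (const_bcontfun 1) x = x"
  using unital by (simp add: E_def A_sel(3))

lemma V_zero [simp]: "V 0 x = x"
  using unital by (simp add: V_def A_sel(3))

lemma E_mult: "E (C_mult f g) x = E f (E g x)"
  using rep_mult[OF single_closed single_closed, of 0 f 0 g x] by (simp add: E_def single_mult)

lemma E_add: "E (f + g) x = E f x + E g x"
proof -
  have "single 0 (f + g) = (\<lambda>n. single 0 f n + single 0 g n)" by (auto simp: single_def)
  then show ?thesis
    using rep_add[OF single_closed single_closed, of 0 f 0 g x] by (simp add: E_def)
qed

lemma E_smult: "E (C_smult c f) x = c *\<^sub>C E f x"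
proof -
  have "C_smult c 0 = (0 :: 'x \<Rightarrow>\<^sub>C complex)" by (rule bcontfun_eqI) (simp add: C_smult.rep_eq)
  then have "single 0 (C_smult c f) = smult A c (single 0 f)" by (auto simp: single_def A_sel)
  then show ?thesis using rep_smult[OF single_closed, of c 0 f x] by (simp add: E_def)
qed

lemma E_zero [simp]: "E 0 x = 0"
  using E_add[of 0 0 x] by simp

lemma E_diff: "E (f - g) x = E f x - E g x"
  using E_add[of "f - g" g x] by simp

lemma E_cnj: "cinner (E (C_cnj g) x) y = cinner x (E g y)"
  using rep_star[OF single_closed, of 0 g x y] by (simp add: E_def single_star)

lemma norm_E: "norm (E g x) \<le> norm g * norm x"
  using norm_rep_le[OF single_closed, of 0 g x] by (simp add: E_def nrm_single)

lemma V_V: "V n (V m x) = V (n + m) x"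
  using rep_mult[OF single_closed single_closed, of n "const_bcontfun 1" m "const_bcontfun 1" x]
  by (simp add: V_def single_mult)

lemma V_adjoint: "cinner (V (- n) x) y = cinner x (V n y)"
  using rep_star[OF single_closed, of n "const_bcontfun 1" x y] by (simp add: V_def single_star)

lemma cinner_V_V: "cinner (V n x) (V m y) = cinner (V (n - m) x) y"
  using V_adjoint[of m "V n x" y] by (simp add: V_V)

lemma norm_V: "norm (V n x) = norm x"
  using cinner_V_V[of n x n x] by (simp add: norm_square_le_cmod power2_eq_iff_nonneg[symmetric])

lemma rep_single: "\<rho> (single n g) x = E g (V n x)"
  using rep_mult[OF single_closed single_closed, of 0 g n "const_bcontfun 1" x]
  by (simp add: E_def V_def single_mult)

lemma V_E: "V n (E g x) = E (\<alpha> n g) (V n x)"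
proof -
  have "V n (E g x) = \<rho> (single n (const_bcontfun 1)) (\<rho> (single 0 g) x)"
    by (simp only: E_def V_def)
  also have "\<dots> = \<rho> (single n (\<alpha> n g)) x"
    using rep_mult[OF single_closed single_closed, of n "const_bcontfun 1" 0 g x]
    by (simp add: single_mult)
  also have "\<dots> = E (\<alpha> n g) (V n x)" by (rule rep_single)
  finally show ?thesis .
qed

text \<open>Covariance in the form that turns a question about the localisation of
  \<open>V n x\<close> into one about \<open>x\<close>.\<close>

lemma E_V: "E g (V n x) = V n (E (\<alpha> (- n) g) x)"
proof -
  have "E g (V n x) = V n (V (- n) (E g (V n x)))" by (simp add: V_V)
  also have "V (- n) (E g (V n x)) = E (\<alpha> (- n) g) x" by (simp add: V_E V_V)
  finally show ?thesis .
qed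

text \<open>The dual of l^1(Z, C(X)) has a supremum norm, so it suffices to bound the functional on
  monomials. A finite cut of \<open>f\<close> is handled termwise and the remainder by
  \<open>norm_rep_le\<close>.\<close>

lemma cinner_rep_le:
  assumes c: "\<And>n g. cmod (cinner (E g (V n \<xi>)) \<eta>) \<le> c * norm g" and f: "f \<in> carrier A"
  shows "cmod (cinner (\<rho> f \<xi>) \<eta>) \<le> c * nrm A f"
proof (rule field_le_epsilon)
  fix e :: real assume e: "0 < e"
  have fs: "(\<lambda>n. norm (f n)) summable_on UNIV" using f by (simp add: A_sel)
  \<comment> \<open>The summand 1 avoids division by zero; the remainder then contributes at most
    \<open>e\<close>.\<close>
  define e' where "e' = e / (norm \<xi> * norm \<eta> + 1)"
  have e': "0 < e'" using e by (simp add: e'_def add_nonneg_pos)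
  obtain F where F: "finite F" "dist (\<Sum>n\<in>F. norm (f n)) (nrm A f) \<le> e'"
    using infsum_finite_approximation[OF fs e'] by (auto simp: A_sel(7))
  define cut where "cut G n = (if n \<in> G then f n else 0)" for G n
  have cut_fin: "cut G \<in> carrier A \<and> \<rho> (cut G) \<xi> = (\<Sum>n\<in>G. E (f n) (V n \<xi>))" if "finite G" for G
    using that
  proof (induction G)
    case empty
    have "cut {} = single 0 0" by (auto simp: cut_def single_def)
    then show ?case by (simp add: single_closed rep_single)
  next
    case (insert n G)
    then have "cut (insert n G) = (\<lambda>m. single n (f n) m + cut G m)"
      by (auto simp: cut_def single_def fun_eq_iff)
    then show ?case
      using insert by (simp add: add_closed single_closed rep_add rep_single)
  qed
  define r where "r n = f n - cut F n" for n
  have rc: "r \<in> carrier A"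
    unfolding r_def using cut_fin[OF F(1)] f by (intro diff_closed) auto
  have s: "(\<lambda>n. norm (f n)) summable_on B" for B
    by (rule summable_on_subset_banach[OF fs]) simp
  have "nrm A r = (\<Sum>\<^sub>\<infinity>n\<in>- F. norm (f n))"
    unfolding A_sel(7) by (rule infsum_cong_neutral) (auto simp: r_def cut_def)
  also have "\<dots> = nrm A f - (\<Sum>n\<in>F. norm (f n))"
    using infsum_Un_disjoint[OF s[of F] s[of "- F"]] F(1) by (simp add: A_sel(7))
  also have "\<dots> \<le> e'" using F(2) by (simp add: dist_real_def)
  finally have r: "nrm A r \<le> e'" .
  have "f = (\<lambda>n. r n + cut F n)" by (simp add: r_def)
  then have "\<rho> f \<xi> = \<rho> r \<xi> + \<rho> (cut F) \<xi>"
    using rep_add[OF rc, of "cut F" \<xi>] cut_fin[OF F(1)] by simp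
  then have "cmod (cinner (\<rho> f \<xi>) \<eta>)
      \<le> cmod (cinner (\<rho> r \<xi>) \<eta>) + cmod (cinner (\<rho> (cut F) \<xi>) \<eta>)"
    by (simp add: cinner_add_left norm_triangle_ineq)
  also have "cmod (cinner (\<rho> r \<xi>) \<eta>) \<le> e' * (norm \<xi> * norm \<eta>)"
  proof -
    have "norm (\<rho> r \<xi>) \<le> e' * norm \<xi>"
      using norm_rep_le[OF rc, of \<xi>] mult_right_mono[OF r, of "norm \<xi>"] by simp
    then show ?thesis
      using cinner_Cauchy_Schwarz[of "\<rho> r \<xi>" \<eta>] mult_right_mono[of "norm (\<rho> r \<xi>)" "e' * norm \<xi>" "norm \<eta>"]
      by (simp add: mult.assoc)
  qed
  also have "e' * (norm \<xi> * norm \<eta>) \<le> e' * (norm \<xi> * norm \<eta> + 1)"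
    using e' by (intro mult_left_mono) auto
  also have "\<dots> = e"
  proof -
    have "0 < norm \<xi> * norm \<eta> + 1" by (simp add: add_nonneg_pos)
    then show ?thesis by (simp add: e'_def)
  qed
  also have "cmod (cinner (\<rho> (cut F) \<xi>) \<eta>) \<le> (\<Sum>n\<in>F. c * norm (f n))"
    using cut_fin[OF F(1)] by (simp add: cinner_sum_left sum_norm_le c)
  also have "\<dots> = c * (\<Sum>n\<in>F. norm (f n))" by (simp add: sum_distrib_left)
  also have "\<dots> \<le> c * nrm A f"
  proof (rule mult_left_mono)
    show "(\<Sum>n\<in>F. norm (f n)) \<le> nrm A f"
      unfolding A_sel(7) by (rule finite_sum_le_infsum[OF fs F(1)]) auto
    \<comment> \<open>Nonnegativity of \<open>c\<close> follows from the hypothesis at the constant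
      function 1, whose norm is positive since the type is inhabited, here by
      \<open>undefined\<close>.\<close>
    have "0 \<le> c * norm (const_bcontfun (1::complex) :: 'x \<Rightarrow>\<^sub>C complex)"
      by (rule order_trans[OF norm_ge_zero c])
    moreover have "0 < norm (const_bcontfun (1::complex) :: 'x \<Rightarrow>\<^sub>C complex)"
      using norm_bounded[of "const_bcontfun (1::complex) :: 'x \<Rightarrow>\<^sub>C complex" undefined] by (simp del: zero_less_norm_iff)
    ultimately show "0 \<le> c" by (simp add: zero_le_mult_iff)
  qed
  finally show "cmod (cinner (\<rho> f \<xi>) \<eta>) \<le> c * nrm A f + e" by simp
qed

section \<open>Consequences of algebraic irreducibility\<close>

lemma algebraically_irreducible_imp_cyclic:
  assumes "algebraically_irreducible A \<rho>" "\<xi> \<noteq> 0"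
  shows "\<exists>f\<in>carrier A. \<rho> f \<xi> = \<zeta>"
proof -
  \<comment> \<open>An invariant subspace, not necessarily closed, which contains
    \<open>\<xi>\<close> because the unit acts as the identity.\<close>
  define M where "M = (\<lambda>f. \<rho> f \<xi>) ` carrier A"
  have "csubspace M"
    unfolding csubspace_def
  proof (intro conjI ballI allI)
    have "\<rho> (single 0 0) \<xi> = 0" by (simp add: rep_single)
    then show "0 \<in> M" unfolding M_def by (metis image_eqI single_closed)
    show "x + y \<in> M" if "x \<in> M" "y \<in> M" for x y
      using that by (auto simp: M_def intro!: image_eqI rep_add[symmetric] add_closed)
    show "c *\<^sub>C x \<in> M" if "x \<in> M" for c x
      using that by (auto simp: M_def intro!: image_eqI rep_smult[symmetric] smult_closed)
  qed
  moreover have "invariant A \<rho> M"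
    by (auto simp: invariant_def M_def intro!: image_eqI rep_mult[symmetric] mult_closed)
  moreover have "\<xi> \<in> M"
    unfolding M_def by (rule image_eqI[of _ _ "\<one>\<^bsub>A\<^esub>"]) (simp_all add: unital A_sel(3) single_closed,
        metis A_sel(3) unital)
  ultimately have "M = UNIV"
    using assms unfolding algebraically_irreducible_def by blast
  then have "\<zeta> \<in> M" by simp
  then show ?thesis by (auto simp: M_def)
qed

text \<open>The open mapping theorem for \<open>f \<mapsto> \<rho> f \<xi>\<close>, seen on the dual side: functionals on \<open>\<ell>\<^sup>1\<close> have the
  supremum norm.\<close>

lemma algebraically_irreducible_imp_lower_bound:
  assumes irr: "algebraically_irreducible A \<rho>" "\<xi> \<noteq> 0"
  shows "\<exists>\<epsilon>>0. \<forall>\<eta>. \<eta> \<noteq> 0 \<longrightarrow>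
    (\<exists>n g. \<epsilon> * norm g * norm \<eta> < cmod (cinner (E g (V n \<xi>)) \<eta>))"
proof (rule ccontr)
  assume contra: "\<not> ?thesis"
  \<comment> \<open>Failure of the bound with constant 1 / (j + 1) yields a vector which, rescaled
    to norm j + 1, pairs with every \<open>E g (V n \<xi>)\<close> to at most
    \<open>norm g\<close>.\<close>
  have "\<exists>\<eta>. norm \<eta> = real (Suc j) \<and> (\<forall>n g. cmod (cinner (E g (V n \<xi>)) \<eta>) \<le> 1 * norm g)" for j
  proof -
    have "0 < 1 / real (Suc j)" by simp
    then obtain \<theta> where \<theta>: "\<theta> \<noteq> 0"
      "\<And>n g. cmod (cinner (E g (V n \<xi>)) \<theta>) \<le> 1 / real (Suc j) * norm g * norm \<theta>"
      using contra by (meson not_less)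
    define \<eta> where "\<eta> = complex_of_real (real (Suc j) / norm \<theta>) *\<^sub>C \<theta>"
    have cm: "cmod (complex_of_real (real (Suc j) / norm \<theta>)) = real (Suc j) / norm \<theta>"
      by (simp only: norm_of_real) simp
    have "norm \<eta> = real (Suc j)"
      unfolding \<eta>_def norm_scaleC cm using \<theta>(1) by simp
    moreover have "cmod (cinner (E g (V n \<xi>)) \<eta>) \<le> 1 * norm g" for n g
    proof -
      have "cmod (cinner (E g (V n \<xi>)) \<eta>)
          = real (Suc j) / norm \<theta> * cmod (cinner (E g (V n \<xi>)) \<theta>)"
        unfolding \<eta>_def cinner_scaleC_right norm_mult complex_mod_cnj cm ..
      also have "\<dots> \<le> real (Suc j) / norm \<theta> * (1 / real (Suc j) * norm g * norm \<theta>)"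
        by (intro mult_left_mono \<theta>(2)) simp
      finally show ?thesis using \<theta>(1) by simp
    qed
    ultimately show ?thesis by blast
  qed
  then obtain \<eta> where \<eta>: "\<And>j. norm (\<eta> j) = real (Suc j)"
    "\<And>j n g. cmod (cinner (E g (V n \<xi>)) (\<eta> j)) \<le> 1 * norm g"
    by metis
  have "\<exists>K. \<forall>j. norm (\<eta> j) \<le> K"
  \<comment> \<open>Every \<open>x\<close> equals \<open>\<rho> f \<xi>\<close> for some
    \<open>f\<close>, and there all functionals are at most \<open>nrm A f\<close>; but their norms
    j + 1 are unbounded.\<close>
  proof (rule functionals_pointwise_bounded_imp_bounded)
    fix x
    obtain f where f: "f \<in> carrier A" "\<rho> f \<xi> = x"
      using algebraically_irreducible_imp_cyclic[OF irr] by blast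
    obtain N :: nat where N: "nrm A f \<le> N" using real_arch_simple by blast
    have "cmod (cinner x (\<eta> j)) \<le> N" for j
      using cinner_rep_le[OF \<eta>(2) f(1), of j] f(2) N by simp
    then show "\<exists>N::nat. \<forall>j. cmod (cinner x (\<eta> j)) \<le> N" by blast
  qed
  then obtain K where K: "\<And>j. real (Suc j) \<le> K" unfolding \<eta>(1) by blast
  obtain j where "K < real j" using reals_Archimedean2 by blast
  then show False using K[of j] by simp
qed

end

section \<open>Isometric systems without periodic points\<close>

text \<open>Depends on \<open>y\<close> only through the distance to \<open>x\<close>, so isometries
  carry bumps to bumps of the same width. The plateau of radius \<open>r\<close> lets wide bumps act
  as the identity on narrow ones.\<close>

definition bump_fun :: "'x::metric_space \<Rightarrow> real \<Rightarrow> 'x \<Rightarrow> real" where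
  "bump_fun x r y = max 0 (min 1 (2 - dist x y / r))"

definition half_bump :: "'x::metric_space \<Rightarrow> real \<Rightarrow> 'x \<Rightarrow>\<^sub>C complex" where
  "half_bump x r = Bcontfun (\<lambda>y. complex_of_real (sqrt (bump_fun x r y)))"

text \<open>A square, so that the operator it acts by is visibly positive.\<close>

definition bump :: "'x::metric_space \<Rightarrow> real \<Rightarrow> 'x \<Rightarrow>\<^sub>C complex" where
  "bump x r = C_mult (half_bump x r) (half_bump x r)"

lemma bump_fun_range: "0 \<le> bump_fun x r y" "bump_fun x r y \<le> 1"
  by (simp_all add: bump_fun_def)

lemma bump_fun_eq_1: "0 < r \<Longrightarrow> dist x y \<le> r \<Longrightarrow> bump_fun x r y = 1"
  by (simp add: bump_fun_def field_simps)

lemma bump_fun_eq_0: "0 < r \<Longrightarrow> 2 * r \<le> dist x y \<Longrightarrow> bump_fun x r y = 0"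
  by (simp add: bump_fun_def field_simps)

lemma half_bump_apply: "apply_bcontfun (half_bump x r) y = complex_of_real (sqrt (bump_fun x r y))"
proof -
  have "continuous_on UNIV (\<lambda>y. complex_of_real (sqrt (bump_fun x r y)))"
    unfolding bump_fun_def divide_inverse by (intro continuous_intros)
  then have "(\<lambda>y. complex_of_real (sqrt (bump_fun x r y))) \<in> bcontfun"
    by (rule bcontfun_normI[where b = 1]) (simp add: bump_fun_range)
  then show ?thesis by (simp add: half_bump_def Bcontfun_inverse)
qed

lemma bump_apply: "apply_bcontfun (bump x r) y = complex_of_real (bump_fun x r y)"
  by (simp add: bump_def C_mult.rep_eq half_bump_apply bump_fun_range flip: of_real_mult)

lemma norm_half_bump_le: "norm (half_bump x r) \<le> 1"
  by (rule norm_bound) (simp add: half_bump_apply bump_fun_range)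

lemma norm_bump_le: "norm (bump x r) \<le> 1"
  by (rule norm_bound) (simp add: bump_apply bump_fun_range)

lemma C_cnj_bump: "C_cnj (half_bump x r) = half_bump x r" "C_cnj (bump x r) = bump x r"
  by (auto intro!: bcontfun_eqI simp: C_cnj.rep_eq half_bump_apply bump_apply)

text \<open>The support of the first bump lies in the closed ball of radius \<open>r'\<close> about
  \<open>x'\<close>, where the second is 1. Bumps thus substitute for nested spectral
  projections.\<close>

lemma C_mult_bump_bump:
  assumes "0 < r" "0 < r'" "dist x x' + 2 * r \<le> r'"
  shows "C_mult (bump x r) (bump x' r') = bump x r"
proof (rule bcontfun_eqI)
  fix y
  show "apply_bcontfun (C_mult (bump x r) (bump x' r')) y = apply_bcontfun (bump x r) y"
  proof (cases "2 * r \<le> dist x y")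
    case True
    then show ?thesis using assms by (simp add: C_mult.rep_eq bump_apply bump_fun_eq_0)
  next
    case False
    then have "dist x' y \<le> r'"
      using assms(3) dist_triangle2[of x' y x] by (simp add: dist_commute)
    then show ?thesis using assms by (simp add: C_mult.rep_eq bump_apply bump_fun_eq_1)
  qed
qed

lemma apply_bcontfun_sum:
  fixes f :: "'i \<Rightarrow> 'x::topological_space \<Rightarrow>\<^sub>C complex"
  shows "apply_bcontfun (sum f K) y = (\<Sum>i\<in>K. apply_bcontfun (f i) y)"
  by (induction K rule: infinite_finite_induct) auto

locale isometric_rep = unital_rep \<sigma> \<rho>
  for \<sigma> :: "'x::metric_space \<Rightarrow> 'x"
    and \<rho> :: "(int \<Rightarrow> 'x \<Rightarrow>\<^sub>C complex) \<Rightarrow> 'h \<Rightarrow> 'h::chilbert_space" +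
  assumes compact: "compact (UNIV :: 'x set)"
    and isometry: "dist (\<sigma> x) (\<sigma> y) = dist x y"
    and no_periodic_points: "\<not> (\<exists>x. \<exists>n>0. (\<sigma> ^^ n) x = x)"
begin

section \<open>Iterates of the isometry\<close>

lemma isometry_funpow: "dist ((\<sigma> ^^ n) x) ((\<sigma> ^^ n) y) = dist x y"
  by (induction n) (simp_all add: isometry)

lemma
  shows funpow_inv: "(\<sigma> ^^ n) ((inv_into UNIV \<sigma> ^^ n) x) = x"
    and inv_funpow: "(inv_into UNIV \<sigma> ^^ n) ((\<sigma> ^^ n) x) = x"
proof -
  have "bij \<sigma>" by (rule bijI') (metis inv_\<sigma>)+
  then show "(\<sigma> ^^ n) ((inv_into UNIV \<sigma> ^^ n) x) = x" "(inv_into UNIV \<sigma> ^^ n) ((\<sigma> ^^ n) x) = x"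
    using fun_cong[OF fn_o_inv_fn_is_id, of \<sigma> n x] fun_cong[OF inv_fn_o_fn_is_id, of \<sigma> n x]
    by simp_all
qed

lemma isometry_\<tau>: "dist (\<tau> k x) (\<tau> k y) = dist x y"
  using isometry_funpow[of "nat (- k)" "\<tau> k x" "\<tau> k y"]
  by (cases "0 \<le> k") (auto simp: int_iterate_def isometry_funpow funpow_inv)

lemma surj_\<tau>: "\<exists>y. \<tau> k y = x"
proof (cases "0 \<le> k")
  case True
  then show ?thesis using funpow_inv[of "nat k" x] by (auto simp: int_iterate_def)
next
  case False
  then show ?thesis using inv_funpow[of "nat (- k)" x] by (auto simp: int_iterate_def)
qed

lemma \<tau>_not_fixed: "k \<noteq> 0 \<Longrightarrow> \<tau> k x \<noteq> x"
proof -
  assume k: "k \<noteq> 0"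
  have "(\<sigma> ^^ n) x \<noteq> x" if "0 < n" for n using no_periodic_points that by blast
  from this[of "nat k"] this[of "nat (- k)"] show ?thesis
    using k funpow_inv[of "nat (- k)" x] by (cases "0 \<le> k") (auto simp: int_iterate_def)
qed

text \<open>The isometry enters here: composing with \<sigma>^n keeps the width of a bump and only
  moves its centre.\<close>

lemma \<alpha>_bump: "\<tau> n y = x \<Longrightarrow> \<alpha> (- n) (bump x r) = bump y r"
  by (rule bcontfun_eqI) (auto simp: \<alpha>_apply bump_apply bump_fun_def isometry_\<tau>)

section \<open>Operators of bump functions\<close>

lemma cinner_E_bump: "cinner (E (bump x r) v) w = cinner v (E (bump x r) w)"
  using E_cnj[of "bump x r" v w] by (simp add: C_cnj_bump)

lemma norm_E_bump_le: "norm (E (bump x r) v) \<le> norm v"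
  using norm_E[of "bump x r" v] mult_right_mono[OF norm_bump_le[of x r], of "norm v"] by simp

text \<open>The operator inequality T^2 \<le> T for a positive contraction T, obtained from its
  square root \<open>half_bump\<close>. It replaces the equality that a projection would
  satisfy.\<close>

lemma norm_E_bump_square: "(norm (E (bump x r) v))\<^sup>2 \<le> Re (cinner (E (bump x r) v) v)"
proof -
  let ?h = "half_bump x r"
  have e: "E (bump x r) v = E ?h (E ?h v)" by (simp add: bump_def E_mult)
  have "norm (E ?h (E ?h v)) \<le> norm (E ?h v)"
    using norm_E[of ?h "E ?h v"] mult_right_mono[OF norm_half_bump_le[of x r], of "norm (E ?h v)"]
    by simp
  then have "(norm (E ?h (E ?h v)))\<^sup>2 \<le> (norm (E ?h v))\<^sup>2" by (simp add: power_mono)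
  also have "complex_of_real ((norm (E ?h v))\<^sup>2) = cinner (E ?h (E ?h v)) v"
    using E_cnj[of ?h "E ?h v" v] by (simp only: C_cnj_bump cinner_same)
  then have "(norm (E ?h v))\<^sup>2 = Re (cinner (E ?h (E ?h v)) v)"
    by (metis Re_complex_of_real)
  finally show ?thesis unfolding e .
qed

text \<open>By compactness finitely many balls of radius \<open>r\<close> cover X, so the sum of
  their bumps is at least 1 and invertible in C(X). If every bump killed \<open>v\<close>, so would
  this sum.\<close>

lemma E_bump_nonzero:
  assumes v: "v \<noteq> 0" and r: "0 < r"
  shows "\<exists>x. E (bump x r) v \<noteq> 0"
proof (rule ccontr)
  assume contra: "\<not> ?thesis"
  obtain K :: "'x set" where K: "finite K" "UNIV \<subseteq> (\<Union>x\<in>K. ball x r)"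
    using conjunct2[OF compact[unfolded compact_eq_totally_bounded], rule_format, OF r] by blast
  define s where "s = (\<Sum>x\<in>K. bump x r)"
  define t where "t y = (\<Sum>x\<in>K. bump_fun x r y)" for y
  have s: "apply_bcontfun s y = complex_of_real (t y)" for y
    by (simp add: s_def t_def apply_bcontfun_sum bump_apply)
  have t: "1 \<le> t y" for y
  proof -
    obtain x where x: "x \<in> K" "dist x y < r" using K by (auto simp: subset_eq)
    have "bump_fun x r y \<le> t y"
      unfolding t_def by (rule member_le_sum) (auto simp: K x bump_fun_range)
    then show ?thesis using x r by (simp add: bump_fun_eq_1)
  qed
  have nz: "apply_bcontfun s y \<noteq> 0" for y using t[of y] by (auto simp: s)
  have "(\<lambda>y. inverse (apply_bcontfun s y)) \<in> bcontfun"
  proof (rule bcontfun_normI[where b = 1])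
    show "continuous_on UNIV (\<lambda>y. inverse (apply_bcontfun s y))"
      by (intro continuous_intros) (auto simp: nz)
    show "norm (inverse (apply_bcontfun s y)) \<le> 1" for y
      using t[of y] by (simp add: s norm_inverse inverse_le_1_iff)
  qed
  then obtain i :: "'x \<Rightarrow>\<^sub>C complex" where i: "\<And>y. apply_bcontfun i y = inverse (apply_bcontfun s y)"
    by (metis Bcontfun_inverse)
  have "C_mult i s = const_bcontfun 1"
    by (rule bcontfun_eqI) (simp add: C_mult.rep_eq i nz)
  then have "E i (E s v) = v"
    using E_mult[of i s v] by simp
  moreover have "E (\<Sum>x\<in>L. bump x r) v = 0" if "finite L" for L
    using that contra by (induction L) (auto simp: E_add)
  ultimately show False using v K(1) by (simp add: s_def E_linear)
qed

text \<open>The vectors \<open>V n \<xi>\<close> are uniformly small on all balls of one radius, since \<open>\<sigma>\<close> permutes these balls.\<close>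

lemma diffuse_imp_small_functional:
  assumes diffuse: "\<And>\<epsilon>. 0 < \<epsilon> \<Longrightarrow> \<exists>r>0. \<forall>x. norm (E (bump x r) \<xi>) \<le> \<epsilon>"
    and "\<xi> \<noteq> 0" "0 < \<epsilon>"
  shows "\<exists>\<eta>. \<eta> \<noteq> 0 \<and> (\<forall>n g. cmod (cinner (E g (V n \<xi>)) \<eta>) \<le> \<epsilon> * norm g * norm \<eta>)"
proof -
  obtain r where r: "0 < r" "\<And>x. norm (E (bump x r) \<xi>) \<le> \<epsilon>"
    using diffuse[OF \<open>0 < \<epsilon>\<close>] by blast
  obtain x where x: "E (bump x (r / 2)) \<xi> \<noteq> 0"
    using E_bump_nonzero[OF \<open>\<xi> \<noteq> 0\<close>, of "r / 2"] r(1) by auto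
  \<comment> \<open>Half the width, so that the bump of width \<open>r\<close> with the same centre
    fixes this vector.\<close>
  define \<eta> where "\<eta> = E (bump x (r / 2)) \<xi>"
  have \<eta>: "E (bump x r) \<eta> = \<eta>"
    using r(1) by (simp add: \<eta>_def E_mult[symmetric] C_mult_commute[of "bump x r"] C_mult_bump_bump)
  have "cmod (cinner (E g (V n \<xi>)) \<eta>) \<le> \<epsilon> * norm g * norm \<eta>" for n g
  proof -
    obtain y where y: "\<tau> n y = x" using surj_\<tau> by blast
    \<comment> \<open>The wide bump is taken off \<open>\<eta>\<close> and moved past
      \<open>E g\<close> and \<open>V n\<close> onto \<open>\<xi>\<close>, where its centre becomes
      \<open>y\<close> and the uniform bound applies.\<close>
    have "cinner (E g (V n \<xi>)) \<eta> = cinner (E (bump x r) (E g (V n \<xi>))) \<eta>"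
      by (simp add: cinner_E_bump \<eta>)
    also have "E (bump x r) (E g (V n \<xi>)) = E g (E (bump x r) (V n \<xi>))"
      by (simp add: E_mult[symmetric] C_mult_commute)
    also have "E (bump x r) (V n \<xi>) = V n (E (bump y r) \<xi>)"
      by (simp add: E_V \<alpha>_bump[OF y])
    also have "cmod (cinner (E g (V n (E (bump y r) \<xi>))) \<eta>) \<le> norm (E g (V n (E (bump y r) \<xi>))) * norm \<eta>"
      by (rule cinner_Cauchy_Schwarz)
    also have "\<dots> \<le> (norm g * norm (E (bump y r) \<xi>)) * norm \<eta>"
      using norm_E[of g "V n (E (bump y r) \<xi>)"] by (intro mult_right_mono) (simp_all add: norm_V)
    also have "\<dots> \<le> (norm g * \<epsilon>) * norm \<eta>"
      by (intro mult_right_mono mult_left_mono r(2)) simp_all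
    finally show ?thesis by (simp add: mult.commute)
  qed
  then show ?thesis using x by (auto simp: \<eta>_def)
qed

text \<open>By compactness the centres of concentration accumulate at some \<open>x\<close>, so
  bumps of every width about \<open>x\<close> see more than \<epsilon>. Cutting \<open>\<xi>\<close>
  by shrinking bumps at \<open>x\<close> gives a Cauchy sequence, whose limit is the component of
  \<open>\<xi>\<close> at the atom \<open>x\<close>.\<close>

lemma concentrated_imp_eigenvector:
  assumes \<epsilon>: "0 < \<epsilon>" and conc: "\<And>r. 0 < r \<Longrightarrow> \<exists>x. \<epsilon> < norm (E (bump x r) \<xi>)"
  shows "\<exists>x \<xi>'. \<xi>' \<noteq> 0 \<and> (\<forall>g. E g \<xi>' = apply_bcontfun g x *\<^sub>C \<xi>')"
proof -
  have "\<exists>x. \<epsilon> < norm (E (bump x (1 / real (Suc j))) \<xi>)" for j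
    by (rule conc) simp
  then obtain X where X: "\<And>j. \<epsilon> < norm (E (bump (X j) (1 / real (Suc j))) \<xi>)" by metis
  obtain x \<phi> where \<phi>: "strict_mono (\<phi> :: nat \<Rightarrow> nat)" "(X \<circ> \<phi>) \<longlonglongrightarrow> x"
    using seq_compactE[OF compact_imp_seq_compact[OF compact], of X] by blast
  \<comment> \<open>Far along the subsequence the bump has width below r / 4 and centre within r / 2
    of \<open>x\<close>, so it is absorbed by \<open>bump x r\<close>.\<close>
  have big: "\<epsilon> < norm (E (bump x r) \<xi>)" if r: "0 < r" for r
  proof -
    have "(\<lambda>j. 1 / real (Suc (\<phi> j))) \<longlonglongrightarrow> 0"
      using LIMSEQ_subseq_LIMSEQ[OF LIMSEQ_inverse_real_of_nat \<phi>(1)]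
      by (simp add: o_def inverse_eq_divide)
    then have "\<forall>\<^sub>F j in sequentially. 1 / real (Suc (\<phi> j)) < r / 4"
      using r by (intro order_tendstoD) auto
    moreover have "\<forall>\<^sub>F j in sequentially. dist ((X \<circ> \<phi>) j) x < r / 2"
      using tendstoD[OF \<phi>(2), of "r / 2"] r by simp
    ultimately have "\<forall>\<^sub>F j in sequentially. 1 / real (Suc (\<phi> j)) < r / 4 \<and> dist (X (\<phi> j)) x < r / 2"
      by eventually_elim simp
    then obtain j where j: "1 / real (Suc (\<phi> j)) < r / 4" "dist (X (\<phi> j)) x < r / 2"
      unfolding eventually_sequentially by blast
    let ?b = "bump (X (\<phi> j)) (1 / real (Suc (\<phi> j)))"
    have "dist (X (\<phi> j)) x + 2 * (1 / real (Suc (\<phi> j))) \<le> r" using j by linarith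
    then have "C_mult ?b (bump x r) = ?b" using r by (intro C_mult_bump_bump) auto
    then have "E ?b \<xi> = E ?b (E (bump x r) \<xi>)" by (metis E_mult)
    then have "norm (E ?b \<xi>) \<le> norm (E (bump x r) \<xi>)" by (metis norm_E_bump_le)
    then show ?thesis using X[of "\<phi> j"] by linarith
  qed
  \<comment> \<open>Halving the width at each step puts the support of each bump inside the plateau
    of all earlier ones.\<close>
  define b where "b j = bump x ((1 / 2) ^ j)" for j :: nat
  define v where "v j = E (b j) \<xi>" for j
  have bb: "C_mult (b j) (b i) = b j" if "i < j" for i j
  proof -
    have "2 * (1 / 2 :: real) ^ j \<le> (1 / 2) ^ i"
      using power_decreasing[of "Suc i" j "1 / 2 :: real"] that by simp
    then show ?thesis unfolding b_def by (intro C_mult_bump_bump) auto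
  qed
  have vv: "v j = E (b j) (v i)" if "i < j" for i j
    unfolding v_def E_mult[symmetric] bb[OF that] ..
  have dec: "(norm (v j))\<^sup>2 \<le> (norm (v i))\<^sup>2" if "i \<le> j" for i j
  proof (cases "i = j")
    case False
    then have "i < j" using that by simp
    then show ?thesis using norm_E_bump_le vv[of i j] unfolding b_def by (simp add: power_mono)
  qed simp
  \<comment> \<open>Pythagoras as an inequality: \<open>cinner (v i) (v j)\<close> equals
    \<open>cinner (v j) \<xi>\<close>, whose real part is at least (norm (v j))^2. Convergence of
    the decreasing norms then makes \<open>v\<close> Cauchy.\<close>
  have diff: "(norm (v i - v j))\<^sup>2 \<le> (norm (v i))\<^sup>2 - (norm (v j))\<^sup>2" if "i \<le> j" for i j
  proof (cases "i = j")
    case False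
    then have ij: "i < j" using that by simp
    have "cinner (v i) (v j) = cinner (E (b j) (v i)) \<xi>"
      by (simp add: v_def b_def cinner_E_bump)
    also have "\<dots> = cinner (v j) \<xi>" using vv[OF ij] by simp
    finally have "(norm (v j))\<^sup>2 \<le> Re (cinner (v i) (v j))"
      using norm_E_bump_square by (simp add: v_def b_def)
    then show ?thesis by (simp add: norm_diff_square)
  qed simp
  have "decseq (\<lambda>j. (norm (v j))\<^sup>2)" unfolding decseq_def using dec by blast
  then have "convergent (\<lambda>j. (norm (v j))\<^sup>2)"
    by (rule decseq_convergent[of _ 0]) (auto simp: convergent_def)
  then have Ca: "Cauchy (\<lambda>j. (norm (v j))\<^sup>2)" by (rule convergent_Cauchy)
  have "Cauchy v"
  proof (rule CauchyI)
    fix e :: real assume e: "0 < e"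
    then obtain N where N: "\<And>m n. m \<ge> N \<Longrightarrow> n \<ge> N \<Longrightarrow> norm ((norm (v m))\<^sup>2 - (norm (v n))\<^sup>2) < e\<^sup>2"
      using CauchyD[OF Ca, of "e\<^sup>2"] by auto
    have less: "norm (v m - v n) < e" if "m \<ge> N" "n \<ge> N" "m \<le> n" for m n
      using N[OF that(1,2)] diff[OF that(3)] e
        power_less_imp_less_base[of "norm (v m - v n)" 2 e]
      by auto
    have "norm (v m - v n) < e" if "m \<ge> N" "n \<ge> N" for m n
      using less[of m n] less[of n m] that by (cases "m \<le> n") (auto simp: norm_minus_commute)
    then show "\<exists>N. \<forall>m\<ge>N. \<forall>n\<ge>N. norm (v m - v n) < e" by blast
  qed
  then obtain \<xi>' where lim: "v \<longlonglongrightarrow> \<xi>'" using Cauchy_convergent convergent_def by blast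
  have "\<epsilon> \<le> norm \<xi>'"
    by (rule LIMSEQ_le_const[OF tendsto_norm[OF lim]]) (auto simp: v_def b_def intro!: less_imp_le big)
  moreover have "E g \<xi>' = apply_bcontfun g x *\<^sub>C \<xi>'" for g
  proof -
    define c where "c = apply_bcontfun g x"
    \<comment> \<open>Vanishes at \<open>x\<close>, hence by continuity is uniformly small on the
      support of \<open>b j\<close> for large \<open>j\<close>; so \<open>E g' (v j)\<close> tends
      to 0.\<close>
    define g' where "g' = g - C_smult c (const_bcontfun 1)"
    have g': "apply_bcontfun g' y = apply_bcontfun g y - c" for y
      by (simp add: g'_def C_smult.rep_eq)
    have "(\<lambda>j. E g' (v j)) \<longlonglongrightarrow> 0"
    proof (rule LIMSEQ_I)
      fix e :: real assume e: "0 < e"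
      define e' where "e' = e / (norm \<xi> + 1)"
      have e': "0 < e'" using e by (simp add: e'_def add_nonneg_pos)
      have "continuous (at x) (apply_bcontfun g)"
        using continuous_on_apply_bcontfun[of UNIV g] by (simp add: continuous_on_eq_continuous_within)
      then obtain d where d: "0 < d" "\<And>y. dist y x < d \<Longrightarrow> dist (apply_bcontfun g y) c < e'"
        using e' unfolding continuous_at_eps_delta c_def by blast
      have "(\<lambda>j. 2 * (1 / 2 :: real) ^ j) \<longlonglongrightarrow> 0"
        by (intro tendsto_mult_right_zero LIMSEQ_power_zero) simp
      then have "\<forall>\<^sub>F j in sequentially. 2 * (1 / 2 :: real) ^ j < d"
        using d(1) by (intro order_tendstoD) auto
      then obtain J where J: "\<And>j. j \<ge> J \<Longrightarrow> 2 * (1 / 2 :: real) ^ j < d"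
        unfolding eventually_sequentially by blast
      have "norm (E g' (v j) - 0) < e" if "j \<ge> J" for j
      proof -
        have "norm (C_mult g' (b j)) \<le> e'"
        proof (rule norm_bound)
          fix y
          show "norm (apply_bcontfun (C_mult g' (b j)) y) \<le> e'"
          proof (cases "2 * (1 / 2) ^ j \<le> dist x y")
            case True
            then show ?thesis using e' by (simp add: C_mult.rep_eq b_def bump_apply bump_fun_eq_0)
          next
            case False
            then have "cmod (apply_bcontfun g' y) \<le> e'"
              using d(2)[of y] J[OF that] by (simp add: g' dist_norm dist_commute)
            then show ?thesis
              using mult_mono[of _ e' "bump_fun x ((1 / 2) ^ j) y" 1] e'
              by (simp add: C_mult.rep_eq b_def bump_apply norm_mult bump_fun_range)
          qed
        qed
        then have "norm (E g' (v j)) \<le> e' * norm \<xi>"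
          using norm_E[of "C_mult g' (b j)" \<xi>] mult_right_mono[of _ e' "norm \<xi>"]
          by (fastforce simp: v_def E_mult)
        also have "\<dots> < e' * (norm \<xi> + 1)" using e' by simp
        also have "\<dots> = e"
          using add_nonneg_pos[OF norm_ge_zero[of \<xi>] zero_less_one] by (simp add: e'_def)
        finally show ?thesis by simp
      qed
      then show "\<exists>J. \<forall>j\<ge>J. norm (E g' (v j) - 0) < e" by blast
    qed
    moreover have "(\<lambda>j. E g' (v j)) \<longlonglongrightarrow> E g' \<xi>'"
      unfolding E_def
      by (rule bounded_linear.tendsto[OF rep_bounded_linear[OF single_closed] lim])
    ultimately have "E g' \<xi>' = 0" by (rule LIMSEQ_unique[symmetric])
    then show ?thesis by (simp add: g'_def E_diff E_smult c_def)
  qed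
  ultimately show ?thesis using \<epsilon> by (metis norm_zero not_less)
qed

text \<open>The functional is the sum of \<open>N\<close> vectors of an orbit, which are orthogonal because
  they have pairwise different eigencharacters.\<close>

lemma eigenvector_imp_small_functional:
  assumes \<xi>: "\<xi> \<noteq> 0" and eig: "\<And>g. E g \<xi> = apply_bcontfun g x *\<^sub>C \<xi>" and \<epsilon>: "0 < \<epsilon>"
  shows "\<exists>\<eta>. \<eta> \<noteq> 0 \<and> (\<forall>n g. cmod (cinner (E g (V n \<xi>)) \<eta>) \<le> \<epsilon> * norm g * norm \<eta>)"
proof -
  have eigV: "E g (V n \<xi>) = apply_bcontfun g (\<tau> n x) *\<^sub>C V n \<xi>" for g n
    by (simp add: E_V eig V_linear \<alpha>_apply)
  have "cinner (V k \<xi>) \<xi> = 0" if k: "k \<noteq> 0" for k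
  proof -
    \<comment> \<open>Half the distance, so that the bump is 1 at \<open>x\<close> and 0 at
      \<open>\<tau> k x\<close> and separates the two eigencharacters.\<close>
    define r where "r = dist x (\<tau> k x) / 2"
    have r: "0 < r" using \<tau>_not_fixed[OF k, of x] by (auto simp: r_def)
    have "cinner (V k \<xi>) \<xi> = cinner (V k \<xi>) (E (bump x r) \<xi>)"
      using r by (simp add: eig bump_apply bump_fun_eq_1)
    also have "\<dots> = cinner (E (bump x r) (V k \<xi>)) \<xi>" by (simp add: cinner_E_bump)
    also have "E (bump x r) (V k \<xi>) = 0"
      using r bump_fun_eq_0[of r x "\<tau> k x"] by (simp add: eigV bump_apply r_def)
    finally show ?thesis by simp
  qed
  then have orth: "cinner (V n \<xi>) (V m \<xi>) = (if n = m then of_real ((norm \<xi>)\<^sup>2) else 0)" for n m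
    by (simp add: cinner_V_V cinner_same)
  \<comment> \<open>Makes the norm of the sum of \<open>N\<close> orthogonal orbit vectors, sqrt N *
    norm \<xi>, at least (norm \<xi>)^2 / \<epsilon>.\<close>
  obtain N :: nat where N: "(norm \<xi> / \<epsilon>)\<^sup>2 \<le> real N" using real_arch_simple by blast
  define \<eta> where "\<eta> = (\<Sum>m<N. V (int m) \<xi>)"
  \<comment> \<open>Each orbit vector meets at most one summand of \<open>\<eta>\<close>, so these
    pairings stay bounded as \<open>N\<close> grows.\<close>
  have inner: "cinner (V n \<xi>) \<eta> = (if n \<in> int ` {..<N} then of_real ((norm \<xi>)\<^sup>2) else 0)" for n
  proof -
    have "cinner (V n \<xi>) \<eta> = (\<Sum>m<N. if n = int m then of_real ((norm \<xi>)\<^sup>2) else 0)"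
      by (simp only: \<eta>_def cinner_sum_right orth)
    also have "\<dots> = (\<Sum>m\<in>int ` {..<N}. if n = m then of_real ((norm \<xi>)\<^sup>2) else 0)"
      by (subst sum.reindex) (simp_all add: o_def)
    also have "\<dots> = (if n \<in> int ` {..<N} then of_real ((norm \<xi>)\<^sup>2) else 0)"
      by (rule sum.delta') simp
    finally show ?thesis .
  qed
  have "cinner \<eta> \<eta> = (\<Sum>n<N. of_real ((norm \<xi>)\<^sup>2))"
    by (subst \<eta>_def) (simp add: cinner_sum_left inner)
  then have "complex_of_real ((norm \<eta>)\<^sup>2) = of_real (real N * (norm \<xi>)\<^sup>2)"
    by (simp add: cinner_same)
  then have n\<eta>: "(norm \<eta>)\<^sup>2 = real N * (norm \<xi>)\<^sup>2" by (simp only: of_real_eq_iff)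
  have "(norm \<xi>)\<^sup>2 \<le> \<epsilon>\<^sup>2 * real N"
    using N \<epsilon> by (simp add: power_divide divide_le_eq mult.commute)
  then have "(norm \<xi>)\<^sup>2 * (norm \<xi>)\<^sup>2 \<le> \<epsilon>\<^sup>2 * real N * (norm \<xi>)\<^sup>2"
    by (rule mult_right_mono) simp
  then have "((norm \<xi>)\<^sup>2)\<^sup>2 \<le> (\<epsilon> * norm \<eta>)\<^sup>2"
    by (simp only: power_mult_distrib n\<eta> power2_eq_square[of "(norm \<xi>)\<^sup>2"] mult.assoc)
  then have le: "(norm \<xi>)\<^sup>2 \<le> \<epsilon> * norm \<eta>"
    by (rule power2_le_imp_le) (use \<epsilon> in simp)
  have "cmod (cinner (E g (V n \<xi>)) \<eta>) \<le> \<epsilon> * norm g * norm \<eta>" for n g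
  proof -
    have "cmod (cinner (E g (V n \<xi>)) \<eta>) \<le> norm g * (norm \<xi>)\<^sup>2"
      by (auto simp: eigV cinner_scaleC_left inner norm_mult norm_power norm_bounded
          intro!: mult_right_mono)
    also have "\<dots> \<le> norm g * (\<epsilon> * norm \<eta>)" by (rule mult_left_mono[OF le]) simp
    finally show ?thesis by (simp add: mult_ac)
  qed
  moreover have "\<eta> \<noteq> 0" using le \<xi> by auto
  ultimately show ?thesis by blast
qed

section \<open>The dichotomy of diffuse and concentrated vectors\<close>

lemma not_algebraically_irreducible:
  assumes "\<exists>v :: 'h. v \<noteq> 0"
  shows "\<not> algebraically_irreducible A \<rho>"
proof
  assume irr: "algebraically_irreducible A \<rho>"
  have "\<exists>\<xi>. \<xi> \<noteq> 0 \<and> (\<forall>\<epsilon>>0. \<exists>\<eta>. \<eta> \<noteq> 0 \<and>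
      (\<forall>n g. cmod (cinner (E g (V n \<xi>)) \<eta>) \<le> \<epsilon> * norm g * norm \<eta>))"
  proof -
    obtain v :: 'h where v: "v \<noteq> 0" using assms by blast
    show ?thesis
    \<comment> \<open>Either \<open>v\<close> has no atom and itself serves as \<open>\<xi>\<close>,
      or a fixed \<epsilon> is exceeded at every radius and an eigenvector at the resulting atom
      serves.\<close>
    proof (cases "\<forall>\<epsilon>>0. \<exists>r>0. \<forall>x. norm (E (bump x r) v) \<le> \<epsilon>")
      case True
      then show ?thesis using diffuse_imp_small_functional[of v] v by blast
    next
      case False
      then obtain \<epsilon> where "0 < \<epsilon>" "\<And>r. 0 < r \<Longrightarrow> \<exists>x. \<epsilon> < norm (E (bump x r) v)"
        by (meson not_le)
      then obtain x \<xi> where "\<xi> \<noteq> 0" "\<And>g. E g \<xi> = apply_bcontfun g x *\<^sub>C \<xi>"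
        using concentrated_imp_eigenvector[of \<epsilon> v] by blast
      then show ?thesis using eigenvector_imp_small_functional[of \<xi> x] by blast
    qed
  qed
  then show False
    using algebraically_irreducible_imp_lower_bound[OF irr] by (meson not_le)
qed

end

section \<open>Passage from the enveloping algebra to l^1\<close>

lemma irreducible_rep_one:
  assumes "ring B" and irr: "irreducible_rep B \<pi>"
  shows "\<pi> \<one>\<^bsub>B\<^esub> x = x"
proof -
  interpret ring B by fact
  have rep: "star_rep B \<pi>" using irr by (simp add: irreducible_rep_def)
  have bl: "bounded_linear (\<pi> \<one>\<^bsub>B\<^esub>)" and sc: "\<pi> \<one>\<^bsub>B\<^esub> (c *\<^sub>C x) = c *\<^sub>C \<pi> \<one>\<^bsub>B\<^esub> x" for c x
    using rep one_closed unfolding star_rep_def bounded_clinear_def by blast+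
  have one: "\<pi> \<one>\<^bsub>B\<^esub> (\<pi> a x) = \<pi> a x" if "a \<in> carrier B" for a x
    using rep that one_closed l_one[OF that] unfolding star_rep_def by metis
  \<comment> \<open>This space contains the range of every \<open>\<pi> a\<close>, so it is
    invariant, and nonzero because the representation is.\<close>
  define M where "M = {x. \<pi> \<one>\<^bsub>B\<^esub> x = x}"
  have "csubspace M"
    using bounded_linear.linear[OF bl]
    by (auto simp: csubspace_def M_def sc linear_0 linear_add)
  moreover have "closed M"
    unfolding M_def
    by (intro closed_Collect_eq bounded_linear.continuous_on[OF bl] continuous_on_id)
  moreover have "invariant B \<pi> M" by (simp add: invariant_def M_def one)
  moreover have "M \<noteq> {0}" using irr one by (auto simp: irreducible_rep_def M_def)
  ultimately have "M = UNIV" using irr unfolding irreducible_rep_def by blast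
  then show ?thesis by (auto simp: M_def)
qed

lemma star_rep_comp:
  assumes hom: "star_hom A B \<iota>" and rep: "star_rep B \<pi>"
  shows "star_rep A (\<lambda>a. \<pi> (\<iota> a))"
proof -
  have ring: "\<iota> \<in> ring_hom A B" using hom by (simp add: star_hom_def)
  note [simp] = ring_hom_closed[OF ring] ring_hom_add[OF ring] ring_hom_mult[OF ring]
  have [simp]: "\<iota> (smult A c a) = smult B c (\<iota> a)" "\<iota> (star A a) = star B (\<iota> a)"
    if "a \<in> carrier A" for c a
    using hom that by (auto simp: star_hom_def)
  show ?thesis using rep unfolding star_rep_def by simp
qed

theorem corollary3p5:
  fixes \<sigma> :: "'x::metric_space \<Rightarrow> 'x"
    and B :: "'b star_algebra"
    and \<iota> :: "(int \<Rightarrow> 'x \<Rightarrow>\<^sub>C complex) \<Rightarrow> 'b"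
    and \<pi> :: "'b \<Rightarrow> 'h \<Rightarrow> 'h::chilbert_space"
  assumes compact: "compact (UNIV :: 'x set)"
    and homeo: "homeomorphism UNIV UNIV \<sigma> (inv_into UNIV \<sigma>)"
    and isometry: "\<And>x y. dist (\<sigma> x) (\<sigma> y) = dist x y"
    and no_periodic_points: "\<not> (\<exists>x. \<exists>n>0. (\<sigma> ^^ n) x = x)"
    and enveloping: "enveloping_cstar_algebra (ell1 \<sigma>) B \<iota>"
    and irreducible: "irreducible_rep B \<pi>"
  shows "\<not> algebraically_irreducible (ell1 \<sigma>) (\<lambda>f. \<pi> (\<iota> f))"
proof -
  have hom: "star_hom (ell1 \<sigma>) B \<iota>" and B: "ring B"
    using enveloping by (auto simp: enveloping_cstar_algebra_def cstar_algebra_def)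
  have rep: "star_rep B \<pi>" using irreducible by (simp add: irreducible_rep_def)
  \<comment> \<open>Members of \<open>ring_hom\<close> preserve the unit, so the unit of l^1 acts as
    the unit of \<open>B\<close>.\<close>
  have one: "\<pi> (\<iota> \<one>\<^bsub>ell1 \<sigma>\<^esub>) x = x" for x
    using hom irreducible_rep_one[OF B irreducible] ring_hom_one[of \<iota> "ell1 \<sigma>" B]
    by (simp add: star_hom_def)
  interpret isometric_rep \<sigma> "\<lambda>f. \<pi> (\<iota> f)"
    using homeo star_rep_comp[OF hom rep] one compact isometry no_periodic_points
    by unfold_locales
  show ?thesis
    \<comment> \<open>A nonzero representation has a nonzero vector in its range.\<close>
    using irreducible by (intro not_algebraically_irreducible) (auto simp: irreducible_rep_def)
qed

end
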